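(* There are infinitely many positive integers $k$ such that $k^2+1$ is square-free. Moreover, for all sufficiently large such $k$, the field $K_k=\mathbb{Q}\big(\sqrt{k^2+1+\sqrt{k^2+1}}\big)$ satisfies \[ 4^{-2/3}\, D_{K_k}^{1/6} \le M(\mathcal{O}_{K_k}) \le 60\, D_{K_k}^{1/6}. \]
   Context: For a nonconstant polynomial $f(x)=c\prod_{i=1}^d (x-\alpha_i)\in\mathbb{C}[x]$, the Mahler measure is $M(f)=|c|\prod_{|\alpha_i|\ge 1}|\alpha_i|$. For an algebraic number $\alpha$, $M(\alpha)$ is the Mahler measure of its minimal polynomial over $\mathbb{Z}$ (with content $1$). For a number field $K$ with ring of integers $\mathcal{O}_K$ and absolute discriminant $D_K$, $M(\mathcal{O}_K)=\min\{M(\alpha):\alpha\in\mathcal{O}_K,\ \mathbb{Q}(\alpha)=K\}$. *)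

theory Defs
  imports Complex_Main "HOL-Computational_Algebra.Computational_Algebra"
    "Jordan_Normal_Form.Determinant"
begin

definition is_subfield :: "complex set \<Rightarrow> bool" where
  "is_subfield F \<longleftrightarrow> 0 \<in> F \<and> 1 \<in> F \<and>
     (\<forall>x\<in>F. \<forall>y\<in>F. x + y \<in> F \<and> x - y \<in> F \<and> x * y \<in> F) \<and>
     (\<forall>x\<in>F. x \<noteq> 0 \<longrightarrow> inverse x \<in> F)"

definition QQ_adj :: "complex \<Rightarrow> complex set" where
  "QQ_adj \<alpha> = \<Inter>{F. is_subfield F \<and> \<alpha> \<in> F}"

definition alg_int :: "complex \<Rightarrow> bool" where
  "alg_int x \<longleftrightarrow> (\<exists>p :: int poly. lead_coeff p = 1 \<and> poly (map_poly of_int p) x = 0)"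

definition ring_of_integers :: "complex set \<Rightarrow> complex set" where
  "ring_of_integers K = {x \<in> K. alg_int x}"

(* field embeddings K -> C (extensional: 0 outside K) *)
definition embedding :: "complex set \<Rightarrow> (complex \<Rightarrow> complex) \<Rightarrow> bool" where
  "embedding K \<sigma> \<longleftrightarrow> \<sigma> 1 = 1 \<and>
     (\<forall>x\<in>K. \<forall>y\<in>K. \<sigma> (x + y) = \<sigma> x + \<sigma> y \<and> \<sigma> (x * y) = \<sigma> x * \<sigma> y) \<and>
     (\<forall>x. x \<notin> K \<longrightarrow> \<sigma> x = 0)"

definition field_trace :: "complex set \<Rightarrow> complex \<Rightarrow> complex" where
  "field_trace K x = (\<Sum>\<sigma>\<in>{\<sigma>. embedding K \<sigma>}. \<sigma> x)"

definition integral_basis :: "complex set \<Rightarrow> nat \<Rightarrow> (nat \<Rightarrow> complex) \<Rightarrow> bool" where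
  "integral_basis K n b \<longleftrightarrow>
     (\<forall>i<n. b i \<in> ring_of_integers K) \<and>
     (\<forall>x\<in>ring_of_integers K. \<exists>c :: nat \<Rightarrow> int. x = (\<Sum>i<n. of_int (c i) * b i)) \<and>
     (\<forall>c :: nat \<Rightarrow> int. (\<Sum>i<n. of_int (c i) * b i) = 0 \<longrightarrow> (\<forall>i<n. c i = 0))"

definition abs_disc :: "complex set \<Rightarrow> real" where
  "abs_disc K = (THE d. \<exists>n b. integral_basis K n b \<and>
       d = cmod (det (mat n n (\<lambda>(i, j). field_trace K (b i * b j)))))"

definition mahler :: "complex poly \<Rightarrow> real" where
  "mahler f = cmod (lead_coeff f) *
     (\<Prod>z\<in>{z. poly f z = 0}. max 1 (cmod z) ^ order z f)"

(* minimal polynomial over Z with content 1 (positive leading coefficient) *)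
definition min_int_poly :: "complex \<Rightarrow> int poly" where
  "min_int_poly \<alpha> = (THE p. irreducible p \<and> lead_coeff p > 0 \<and>
       poly (map_poly of_int p) \<alpha> = 0)"

definition mahler_alg :: "complex \<Rightarrow> real" where
  "mahler_alg \<alpha> = mahler (map_poly of_int (min_int_poly \<alpha>))"

definition mahler_OK :: "complex set \<Rightarrow> real" where
  "mahler_OK K = Inf {mahler_alg \<alpha> | \<alpha>. \<alpha> \<in> ring_of_integers K \<and> QQ_adj \<alpha> = K}"

definition K_field :: "nat \<Rightarrow> complex set" where
  "K_field k = QQ_adj (complex_of_real (sqrt (real (k^2 + 1) + sqrt (real (k^2 + 1)))))"

end

theory Submission
  imports Defs "HOL-Number_Theory.Number_Theory" "HOL-Analysis.Convex"
    "Jordan_Normal_Form.Char_Poly"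
begin

text \<open>
  Write \<open>m = k\<^sup>2 + 1\<close>, \<open>s = \<surd>m\<close>, \<open>t = \<surd>(m + s)\<close>, \<open>u = \<surd>(m - s)\<close>. Then \<open>t u = k s\<close>, so \<open>K\<close> is cyclic with
  rational basis \<open>1, s, t, u\<close>, and for squarefree \<open>m\<close> an integral basis is obtained by replacing \<open>s\<close> by
  \<open>(1 + s) / 2\<close> if \<open>k\<close> is even; hence the discriminant is \<open>256 m\<^sup>3\<close> or \<open>64 m\<^sup>3\<close>.
  The lower bound is Mahler's: the discriminant is at most that of \<open>1, \<alpha>, \<alpha>\<^sup>2, \<alpha>\<^sup>3\<close>, the square of a
  Vandermonde determinant, and Hadamard's inequality bounds the latter by \<open>4\<^sup>4 M(\<alpha>)\<^sup>6\<close>.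
  For the upper bound take \<open>\<alpha> = k - s + t - u\<close>, whose conjugates are bounded except for one of
  size about \<open>4 k\<close>.
  A nonsquarefree \<open>k\<^sup>2 + 1\<close> is divisible by \<open>p\<^sup>2\<close> for a prime \<open>p \<le> k\<close> with \<open>p \<equiv> 1 (mod 4)\<close>; since
  \<open>k\<^sup>2 + 1\<close> has at most two roots modulo \<open>p\<^sup>2\<close>, this excludes at most \<open>3 N / 4\<close> of the \<open>k \<le> N\<close>.
\<close>

section \<open>Squarefree values of \<open>k\<^sup>2 + 1\<close>\<close>

text \<open>The sieve uses no estimate on the number of primes. A modulus p^2 excludes at most 2 (N
  div p^2 + 1) values, and for large p only the rounding term 2 counts; over all odd p \<le> N it
  would already cost about N. The residue condition leaves the moduli p = 4 j + 1 with j \<le> N /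
  4, so rounding costs at most N / 2 and the main terms at most N / 4.

  The field is treated through rational coordinates. Its four embeddings become four real
  substitutions for s, t, u that obey one common multiplication table, so identities in K turn into
  polynomial identities over the rationals. Integrality is only ever tested in the quadratic
  subfield Q(s), where trace and norm decide it; a quartic integer is projected there by its
  relative trace, its relative norm and the square of its difference from the relative conjugate.
  The resulting congruences modulo 4 fix the ring of integers.

  All conjugates are real, so Hadamard's inequality is only required for real 4 x 4
  matrices.\<close>

lemma prime_dvd_square_plus_1_imp_mod_4:
  fixes p k :: nat
  assumes "prime p" "p \<noteq> 2" "p dvd k\<^sup>2 + 1"
  shows "p mod 4 = 1"
proof -
  have odd: "odd p" using assms(1,2) primes_dvd_imp_eq two_is_prime_nat by blast
  have p2: "p > 2" using assms(1,2) prime_ge_2_nat[of p] by linarith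
  show ?thesis
  proof (rule ccontr)
    assume "p mod 4 \<noteq> 1"
    then have "p mod 4 = 3" using odd by presburger
    then obtain q where q: "p = 4 * q + 3" by (metis add.commute mod_div_mult_eq mult.commute)
    have nd: "\<not> p dvd k"
    proof
      assume "p dvd k"
      then have "p dvd k\<^sup>2" by (simp add: power2_eq_square)
      then have "p dvd 1" using assms(3) dvd_add_right_iff by blast
      then show False using p2 by simp
    qed
    have 1: "[k ^ (p - 1) = 1] (mod p)"
      using fermat_theorem[OF assms(1) nd] .
    have "[int k ^ 2 = -1] (mod int p)"
      using assms(3) unfolding cong_iff_dvd_diff
      by (metis (mono_tags, lifting) diff_minus_eq_add int_dvd_int_iff of_nat_1 of_nat_add of_nat_power)
    \<comment> \<open>Since \<open>p - 1 = 2 * (2 * q + 1)\<close>, the left side is the power in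
      Fermat's theorem, while the odd exponent leaves -1 on the right; hence p would divide
      2.\<close>
    then have "[(int k ^ 2) ^ (2 * q + 1) = (-1) ^ (2 * q + 1)] (mod int p)"
      by (rule cong_pow)
    moreover have "(int k ^ 2) ^ (2 * q + 1) = int (k ^ (p - 1))"
      by (simp add: q power_mult[symmetric] del: power_Suc)
    moreover have "[int (k ^ (p - 1)) = int 1] (mod int p)"
      using 1 cong_int_iff by blast
    ultimately have "[int 1 = (-1) ^ (2 * q + 1)] (mod int p)"
      by (metis cong_sym cong_trans)
    then have "int p dvd 2" by (simp add: cong_iff_dvd_diff)
    then show False using p2 zdvd_imp_le by fastforce
  qed
qed

lemma card_residue_class_le:
  fixes N q r :: nat
  assumes "q > 0"
  shows "card {b \<in> {1..N}. b mod q = r} \<le> N div q + 1"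
proof -
  have "inj_on (\<lambda>b. b div q) {b \<in> {1..N}. b mod q = r}"
    by (rule inj_onI) (metis (mono_tags, lifting) div_mod_decomp mem_Collect_eq)
  moreover have "(\<lambda>b. b div q) ` {b \<in> {1..N}. b mod q = r} \<subseteq> {..N div q}"
    by (auto simp: div_le_mono)
  ultimately have "card {b \<in> {1..N}. b mod q = r} \<le> card {..N div q}"
    by (meson card_inj_on_le finite_atMost)
  then show ?thesis by simp
qed

text \<open>For two roots a and b, p^2 divides (b - a) (b + a). The odd prime p cannot divide both
  factors: it would divide 2 b, hence b, hence 1. So all of p^2 sits in one factor, and b is
  congruent to a or to -a.\<close>

lemma card_roots_square_plus_1_le:
  fixes p N :: nat
  assumes "prime p" "p \<noteq> 2"
  shows "card {k \<in> {1..N}. p\<^sup>2 dvd k\<^sup>2 + 1} \<le> 2 * (N div p\<^sup>2 + 1)"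
proof (cases "{k \<in> {1..N}. p\<^sup>2 dvd k\<^sup>2 + 1} = {}")
  case True
  then show ?thesis by (simp only: card.empty)
next
  case False
  then obtain a where a: "p\<^sup>2 dvd a\<^sup>2 + 1" by blast
  have p2: "p > 2" using assms(1,2) prime_ge_2_nat[of p] by linarith
  have pp: "prime (int p)" using assms by simp
  define r where "r = nat ((- int a) mod int (p\<^sup>2))"
  have *: "b mod p\<^sup>2 = a mod p\<^sup>2 \<or> b mod p\<^sup>2 = r" if b: "p\<^sup>2 dvd b\<^sup>2 + 1" for b
  proof -
    have ia: "int p ^ 2 dvd int a ^ 2 + 1"
      using a[folded int_dvd_int_iff] by (simp add: add.commute)
    have ib: "int p ^ 2 dvd int b ^ 2 + 1"
      using b[folded int_dvd_int_iff] by (simp add: add.commute)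
    have d: "int p ^ 2 dvd (int b - int a) * (int b + int a)"
      using dvd_diff[OF ib ia] by (simp add: algebra_simps power2_eq_square)
    have nb: "\<not> (int p dvd int b - int a \<and> int p dvd int b + int a)"
    proof
      assume "int p dvd int b - int a \<and> int p dvd int b + int a"
      then have "int p dvd (int b - int a) + (int b + int a)" by (meson dvd_add)
      then have "int p dvd 2 * int b" by simp
      then have "int p dvd int b"
        using pp p2 prime_dvd_mult_iff[of "int p" 2 "int b"] zdvd_imp_le[of "int p" 2] by auto
      then have "int p dvd int b ^ 2" by (simp add: power2_eq_square)
      moreover have "int p dvd int b ^ 2 + 1" using ib by (meson dvd_power dvd_trans pos2)
      ultimately have "int p dvd 1" using dvd_add_right_iff by blast
      then show False using p2 by simp
    qed
    then have "int p ^ 2 dvd int b - int a \<or> int p ^ 2 dvd int b + int a"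
    proof (cases "int p dvd int b - int a")
      case True
      then have "coprime (int p ^ 2) (int b + int a)"
        using nb pp by (simp add: prime_imp_coprime)
      then show ?thesis using d coprime_dvd_mult_left_iff by blast
    next
      case False
      then have "coprime (int p ^ 2) (int b - int a)"
        using pp by (simp add: prime_imp_coprime)
      then show ?thesis using d coprime_dvd_mult_right_iff by blast
    qed
    then show ?thesis
    proof
      assume "int p ^ 2 dvd int b - int a"
      then have "int b mod int (p\<^sup>2) = int a mod int (p\<^sup>2)"
        by (simp add: mod_eq_dvd_iff)
      then show ?thesis by (metis nat_int zmod_int)
    next
      assume "int p ^ 2 dvd int b + int a"
      then have "int b mod int (p\<^sup>2) = (- int a) mod int (p\<^sup>2)"
        by (simp add: mod_eq_dvd_iff)
      then show ?thesis unfolding r_def by (metis nat_int zmod_int)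
    qed
  qed
  have "{k \<in> {1..N}. p\<^sup>2 dvd k\<^sup>2 + 1} \<subseteq>
      {b \<in> {1..N}. b mod p\<^sup>2 = a mod p\<^sup>2} \<union> {b \<in> {1..N}. b mod p\<^sup>2 = r}"
    using * by auto
  then have "card {k \<in> {1..N}. p\<^sup>2 dvd k\<^sup>2 + 1} \<le>
      card ({b \<in> {1..N}. b mod p\<^sup>2 = a mod p\<^sup>2} \<union> {b \<in> {1..N}. b mod p\<^sup>2 = r})"
    by (intro card_mono) auto
  also have "\<dots> \<le> card {b \<in> {1..N}. b mod p\<^sup>2 = a mod p\<^sup>2} + card {b \<in> {1..N}. b mod p\<^sup>2 = r}"
    by (rule card_Un_le)
  also have "\<dots> \<le> (N div p\<^sup>2 + 1) + (N div p\<^sup>2 + 1)"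
    using p2 by (intro add_mono card_residue_class_le) auto
  finally show ?thesis by simp
qed

lemma sum_inverse_squares_le: "(\<Sum>j = 1..n. 1 / real j ^ 2) \<le> 2"
proof (cases n)
  case (Suc l)
  \<comment> \<open>The sharper bound 2 - 1/n is the one that telescopes under induction.\<close>
  have "(\<Sum>j = 1..Suc l. 1 / real j ^ 2) \<le> 2 - 1 / real (Suc l)"
  proof (induction l)
    case (Suc l)
    have "1 / real (Suc (Suc l)) ^ 2 \<le> 1 / real (Suc l) - 1 / real (Suc (Suc l))"
      by (simp add: divide_simps power2_eq_square)
    then show ?case using Suc by simp
  qed simp
  moreover have "1 / real (Suc l) \<ge> 0" by simp
  ultimately show ?thesis unfolding Suc by linarith
qed simp

lemma not_squarefree_square_plus_1D:
  fixes k :: nat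
  assumes "\<not> squarefree (k\<^sup>2 + 1)" "k > 0"
  obtains p where "prime p" "p mod 4 = 1" "p \<le> k" "p\<^sup>2 dvd k\<^sup>2 + 1"
proof -
  from assms obtain x where x: "x\<^sup>2 dvd k\<^sup>2 + 1" "\<not> x dvd 1"
    unfolding squarefree_def by blast
  then obtain p where p: "prime p" "p dvd x" using prime_factor_nat[of x] by auto
  have d: "p\<^sup>2 dvd k\<^sup>2 + 1" using p(2) x(1) by (meson dvd_power_same dvd_trans)
  have pd: "p dvd k\<^sup>2 + 1" using d by (meson dvd_power dvd_trans pos2)
  have "p \<noteq> 2"
  proof
    assume "p = 2"
    then have "4 dvd k\<^sup>2 + 1" using d by simp
    moreover have "k\<^sup>2 mod 4 = 0 \<or> k\<^sup>2 mod 4 = 1"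
    proof -
      have "k mod 4 = 0 \<or> k mod 4 = 1 \<or> k mod 4 = 2 \<or> k mod 4 = 3" by presburger
      then have "(k mod 4)\<^sup>2 mod 4 = 0 \<or> (k mod 4)\<^sup>2 mod 4 = 1" by auto
      then show ?thesis by (simp add: power_mod)
    qed
    ultimately show False by presburger
  qed
  then have m4: "p mod 4 = 1" using prime_dvd_square_plus_1_imp_mod_4 p(1) pd by blast
  have "p \<le> k"
  proof (rule ccontr)
    assume "\<not> p \<le> k"
    then have "(k + 1)\<^sup>2 \<le> p\<^sup>2" by (intro power_mono) auto
    moreover have "p\<^sup>2 \<le> k\<^sup>2 + 1" using d by (rule dvd_imp_le) simp
    ultimately show False using assms(2) by (simp add: power2_eq_square)
  qed
  then show thesis using that p(1) m4 d by blast
qed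

lemma card_not_squarefree_square_plus_1_le:
  "real (card {k \<in> {1..N}. \<not> squarefree (k\<^sup>2 + 1)}) \<le> 3 / 4 * real N"
proof -
  define S where "S = (\<lambda>j. if prime (4 * j + 1) then {k \<in> {1..N}. (4 * j + 1)\<^sup>2 dvd k\<^sup>2 + 1} else {})"
  have "{k \<in> {1..N}. \<not> squarefree (k\<^sup>2 + 1)} \<subseteq> (\<Union>j\<in>{1..N div 4}. S j)"
  proof
    fix k assume k: "k \<in> {k \<in> {1..N}. \<not> squarefree (k\<^sup>2 + 1)}"
    then obtain p where p: "prime p" "p mod 4 = 1" "p \<le> k" "p\<^sup>2 dvd k\<^sup>2 + 1"
      using not_squarefree_square_plus_1D[of k] by auto
    define j where "j = p div 4"
    have pj: "p = 4 * j + 1" using p(2) unfolding j_def by presburger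
    have "j \<noteq> 0" using p(1) pj by (cases j) auto
    moreover have "j \<le> N div 4" unfolding j_def using p(3) k by (intro div_le_mono) auto
    moreover have "k \<in> S j" using p k pj unfolding S_def by auto
    ultimately show "k \<in> (\<Union>j\<in>{1..N div 4}. S j)" by (intro UN_I[of j]) auto
  qed
  then have "card {k \<in> {1..N}. \<not> squarefree (k\<^sup>2 + 1)} \<le> card (\<Union>j\<in>{1..N div 4}. S j)"
    by (intro card_mono) (auto simp: S_def)
  also have "\<dots> \<le> (\<Sum>j = 1..N div 4. card (S j))" by (rule card_UN_le) simp
  finally have "real (card {k \<in> {1..N}. \<not> squarefree (k\<^sup>2 + 1)}) \<le> (\<Sum>j = 1..N div 4. real (card (S j)))"
    by (simp flip: of_nat_sum)
  \<comment> \<open>From (4 j + 1)^2 \<ge> 16 j^2; the two residue classes turn N / 16 into N / 8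
    and leave a rounding loss of 2.\<close>
  also have "\<dots> \<le> (\<Sum>j = 1..N div 4. real N / 8 * (1 / real j ^ 2) + 2)"
  proof (rule sum_mono)
    fix j assume j: "j \<in> {1..N div 4}"
    show "real (card (S j)) \<le> real N / 8 * (1 / real j ^ 2) + 2"
    proof (cases "prime (4 * j + 1)")
      case True
      have "card (S j) \<le> 2 * (N div (4 * j + 1)\<^sup>2 + 1)"
        using card_roots_square_plus_1_le[OF True, of N] j True unfolding S_def by auto
      then have "real (card (S j)) \<le> 2 * (real (N div (4 * j + 1)\<^sup>2) + 1)"
        by (simp flip: of_nat_le_iff[where 'a = real])
      also have "real (N div (4 * j + 1)\<^sup>2) \<le> real N / real ((4 * j + 1)\<^sup>2)"
        by (rule of_nat_div_le_of_nat)
      also have "\<dots> \<le> real N / (16 * real j ^ 2)"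
        using j by (intro divide_left_mono mult_pos_pos) (auto simp: power2_eq_square algebra_simps intro!: add_pos_nonneg)
      finally show ?thesis by simp
    next
      case False
      then show ?thesis by (simp add: S_def)
    qed
  qed
  also have "\<dots> = real N / 8 * (\<Sum>j = 1..N div 4. 1 / real j ^ 2) + 2 * real (N div 4)"
    by (simp add: sum.distrib sum_distrib_left)
  also have "\<dots> \<le> real N / 8 * 2 + 2 * (real N / 4)"
    using of_nat_div_le_of_nat[of N 4, where 'a = real]
    by (intro add_mono mult_left_mono sum_inverse_squares_le) auto
  finally show ?thesis by simp
qed

lemma infinite_squarefree_square_plus_1:
  "infinite {k :: nat. k > 0 \<and> squarefree (k\<^sup>2 + 1)}"
proof
  let ?G = "{k :: nat. k > 0 \<and> squarefree (k\<^sup>2 + 1)}"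
  assume fin: "finite ?G"
  \<comment> \<open>At least N / 4 = \<open>card ?G + 1\<close> of the k \<le> N survive the sieve,
    one more than \<open>?G\<close> can hold.\<close>
  define N where "N = 4 * card ?G + 4"
  let ?B = "{k \<in> {1..N}. \<not> squarefree (k\<^sup>2 + 1)}"
  have "{1..N} \<subseteq> ?G \<union> ?B" by auto
  then have "card {1..N} \<le> card (?G \<union> ?B)" using fin by (intro card_mono) auto
  also have "\<dots> \<le> card ?G + card ?B" by (rule card_Un_le)
  finally have "real N \<le> real (card ?G) + real (card ?B)" by simp
  also have "\<dots> \<le> real (card ?G) + 3 / 4 * real N"
    using card_not_squarefree_square_plus_1_le[of N] by simp
  finally show False unfolding N_def by simp
qed

section \<open>Algebraic integers form a ring\<close>

lemma alg_int_iff_algebraic_int: "alg_int x \<longleftrightarrow> algebraic_int x"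
  unfolding alg_int_def algebraic_int_altdef_ipoly by auto

text \<open>The vector of the \<open>v i\<close> is an eigenvector of the integer matrix M, so z is
  a root of its characteristic polynomial, which is monic and integral.\<close>

lemma alg_int_eigenvalueI:
  fixes M :: "nat \<Rightarrow> nat \<Rightarrow> int"
  assumes "\<And>i. i < n \<Longrightarrow> z * v i = (\<Sum>j<n. of_int (M i j) * v j)"
    and "i < n" "v i \<noteq> 0"
  shows "alg_int z"
proof -
  define A :: "int mat" where "A = mat n n (\<lambda>(i, j). M i j)"
  define B :: "complex mat" where "B = map_mat of_int A"
  have A: "A \<in> carrier_mat n n" and B: "B \<in> carrier_mat n n" by (auto simp: A_def B_def)
  have "eigenvector B (vec n v) z"
    unfolding eigenvector_def
  proof (intro conjI)
    show "vec n v \<noteq> 0\<^sub>v (dim_row B)" using assms(2,3) B by (auto simp: vec_eq_iff)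
    show "B *\<^sub>v vec n v = z \<cdot>\<^sub>v vec n v"
      using assms(1) by (intro eq_vecI)
        (auto simp: A_def B_def scalar_prod_def lessThan_atLeast0 intro!: sum.cong)
  qed (use B in auto)
  then have "poly (char_poly B) z = 0"
    using eigenvalue_root_char_poly[OF B] unfolding eigenvalue_def by blast
  then have "poly (map_poly of_int (char_poly A)) z = 0"
    unfolding B_def of_int_hom.char_poly_hom[OF A] .
  moreover have "lead_coeff (char_poly A) = 1" using degree_monic_char_poly[OF A] by simp
  ultimately show ?thesis unfolding alg_int_def by blast
qed

text \<open>For finite I, a finitely generated Z-module. Generators form a family rather than a set,
  so that the products x^i y^j can be indexed by pairs even if some coincide.\<close>

definition zspan :: "('i \<Rightarrow> complex) \<Rightarrow> 'i set \<Rightarrow> complex set" where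
  "zspan g I = range (\<lambda>c. \<Sum>i\<in>I. of_int (c i) * g i)"

lemma zspan_add: "x \<in> zspan g I \<Longrightarrow> y \<in> zspan g I \<Longrightarrow> x + y \<in> zspan g I"
  unfolding zspan_def
proof (elim rangeE)
  fix c d
  assume "x = (\<Sum>i\<in>I. of_int (c i) * g i)" "y = (\<Sum>i\<in>I. of_int (d i) * g i)"
  then show "x + y \<in> range (\<lambda>c. \<Sum>i\<in>I. of_int (c i) * g i)"
    by (intro range_eqI[of _ _ "\<lambda>i. c i + d i"]) (simp add: sum.distrib algebra_simps)
qed

lemma zspan_scale: "x \<in> zspan g I \<Longrightarrow> of_int a * x \<in> zspan g I"
  unfolding zspan_def
proof (elim rangeE)
  fix c
  assume "x = (\<Sum>i\<in>I. of_int (c i) * g i)"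
  then show "of_int a * x \<in> range (\<lambda>c. \<Sum>i\<in>I. of_int (c i) * g i)"
    by (intro range_eqI[of _ _ "\<lambda>i. a * c i"]) (simp add: sum_distrib_left algebra_simps)
qed

lemma zspan_0: "0 \<in> zspan g I"
  unfolding zspan_def by (rule range_eqI[of _ _ "\<lambda>_. 0"]) simp

lemma zspan_sum: "(\<And>j. j \<in> J \<Longrightarrow> f j \<in> zspan g I) \<Longrightarrow> sum f J \<in> zspan g I"
  by (induction J rule: infinite_finite_induct) (auto intro: zspan_0 zspan_add)

lemma zspan_base: "finite I \<Longrightarrow> i \<in> I \<Longrightarrow> g i \<in> zspan g I"
  unfolding zspan_def
  by (rule range_eqI[of _ _ "\<lambda>j. if j = i then 1 else 0"]) (simp add: if_distrib if_distribR sum.delta cong: if_cong)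

lemma zspan_stable:
  assumes "\<And>i. i \<in> I \<Longrightarrow> z * g i \<in> zspan g I" "v \<in> zspan g I"
  shows "z * v \<in> zspan g I"
proof -
  obtain c where "v = (\<Sum>i\<in>I. of_int (c i) * g i)" using assms(2) unfolding zspan_def by blast
  then have "z * v = (\<Sum>i\<in>I. of_int (c i) * (z * g i))" by (simp add: sum_distrib_left algebra_simps)
  also have "\<dots> \<in> zspan g I" by (intro zspan_sum zspan_scale assms(1))
  finally show ?thesis .
qed

text \<open>The determinant trick: multiplication by z on a finitely generated module is given by an
  integer matrix. The bijection \<open>h\<close> only renumbers the generators.\<close>

lemma alg_int_stableI:
  assumes "finite I" "\<And>i. i \<in> I \<Longrightarrow> z * g i \<in> zspan g I" "i \<in> I" "g i \<noteq> 0"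
  shows "alg_int z"
proof -
  obtain h where h: "bij_betw h {..<card I} I"
    using ex_bij_betw_nat_finite[OF assms(1)] by (auto simp: lessThan_atLeast0)
  have "\<exists>c. z * g (h l) = (\<Sum>i\<in>I. of_int (c i) * g i)" if "l < card I" for l
    using assms(2)[of "h l"] bij_betwE[OF h] that unfolding zspan_def by fastforce
  then have "\<forall>l. \<exists>c. l < card I \<longrightarrow> z * g (h l) = (\<Sum>i\<in>I. of_int (c i) * g i)" by blast
  then obtain c where c: "\<And>l. l < card I \<Longrightarrow> z * g (h l) = (\<Sum>i\<in>I. of_int (c l i) * g i)"
    unfolding choice_iff by blast
  have "i \<in> h ` {..<card I}" using bij_betw_imp_surj_on[OF h] assms(3) by simp
  then obtain l where l: "l < card I" "h l = i" by auto
  show ?thesis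
  proof (rule alg_int_eigenvalueI[where v = "\<lambda>l. g (h l)" and M = "\<lambda>l l'. c l (h l')"])
    fix l assume "l < card I"
    then show "z * g (h l) = (\<Sum>j<card I. of_int (c l (h j)) * g (h j))"
      using c sum.reindex_bij_betw[OF h, of "\<lambda>i. of_int (c l i) * g i"] by simp
  qed (use l assms(4) in auto)
qed

lemma alg_int_power_reduction:
  assumes "alg_int x"
  obtains n and a :: "nat \<Rightarrow> int"
    where "n > 0" "x ^ n = (\<Sum>i<n. of_int (a i) * x ^ i)"
proof -
  obtain p :: "int poly" where p: "lead_coeff p = 1" "poly (map_poly of_int p) x = 0"
    using assms unfolding alg_int_def by blast
  have "(\<Sum>i\<le>degree p. of_int (poly.coeff p i) * x ^ i) = 0"
    using p(2) by (simp add: poly_altdef)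
  then have *: "x ^ degree p = (\<Sum>i<degree p. of_int (- poly.coeff p i) * x ^ i)"
    using p(1) by (simp add: lessThan_Suc_atMost[symmetric] sum_negf eq_neg_iff_add_eq_0 add.commute)
  \<comment> \<open>In degree 0 the relation would read 1 = 0.\<close>
  moreover have "degree p > 0" using * by (cases "degree p = 0") auto
  ultimately show thesis using that[of "degree p" "\<lambda>i. - poly.coeff p i"] by blast
qed

text \<open>The module generated by x^i y^j for i < n and j < l is stable under x and under y,
  because x^n and y^l reduce to lower powers; hence it is stable under the sum and the
  product.\<close>

lemma alg_int_add_mult:
  assumes "alg_int x" "alg_int y"
  shows "alg_int (x + y)" "alg_int (x * y)"
proof -
  obtain n a where n: "n > 0" and a: "x ^ n = (\<Sum>i<n. of_int (a i) * x ^ i)"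
    using alg_int_power_reduction[OF assms(1)] .
  obtain l b where l: "l > 0" and b: "y ^ l = (\<Sum>i<l. of_int (b i) * y ^ i)"
    using alg_int_power_reduction[OF assms(2)] .
  define I where "I = {..<n} \<times> {..<l}"
  define g where "g = (\<lambda>(i, j). x ^ i * y ^ j)"
  have fin: "finite I" by (simp add: I_def)
  have gI: "x ^ i * y ^ j \<in> zspan g I" if "i < n" "j < l" for i j
    using zspan_base[OF fin, of "(i, j)" g] that by (simp add: g_def I_def)
  have x: "x * g i \<in> zspan g I" if i: "i \<in> I" for i
  proof -
    obtain i1 i2 where i: "i = (i1, i2)" "i1 < n" "i2 < l" using i by (auto simp: I_def)
    show ?thesis
    proof (cases "Suc i1 < n")
      case True
      then show ?thesis using gI[of "Suc i1" i2] i by (simp add: g_def algebra_simps)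
    next
      case False
      then have "Suc i1 = n" using i by simp
      then have "x * g i = x ^ n * y ^ i2" using i by (auto simp: g_def)
      also have "\<dots> = (\<Sum>j<n. of_int (a j) * (x ^ j * y ^ i2))"
        by (simp add: a sum_distrib_right mult.assoc)
      also have "\<dots> \<in> zspan g I" by (intro zspan_sum zspan_scale gI) (use i in auto)
      finally show ?thesis .
    qed
  qed
  have y: "y * g i \<in> zspan g I" if i: "i \<in> I" for i
  proof -
    obtain i1 i2 where i: "i = (i1, i2)" "i1 < n" "i2 < l" using i by (auto simp: I_def)
    show ?thesis
    proof (cases "Suc i2 < l")
      case True
      then show ?thesis using gI[of i1 "Suc i2"] i by (simp add: g_def algebra_simps)
    next
      case False
      then have "Suc i2 = l" using i by simp
      then have "y * g i = x ^ i1 * y ^ l" using i by (auto simp: g_def)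
      also have "\<dots> = (\<Sum>j<l. of_int (b j) * (x ^ i1 * y ^ j))"
        by (simp add: b sum_distrib_left algebra_simps)
      also have "\<dots> \<in> zspan g I" by (intro zspan_sum zspan_scale gI) (use i in auto)
      finally show ?thesis .
    qed
  qed
  have 0: "(0, 0) \<in> I" "g (0, 0) \<noteq> 0" using n l by (auto simp: I_def g_def)
  show "alg_int (x + y)"
    by (rule alg_int_stableI[where g = g and I = I and i = "(0, 0)"]) (simp_all add: distrib_right zspan_add x y fin 0)
  show "alg_int (x * y)"
    by (rule alg_int_stableI[where g = g and I = I and i = "(0, 0)"]) (simp_all add: mult.assoc zspan_stable x y fin 0)
qed

lemma alg_int_of_int [simp]: "alg_int (of_int n)"
  unfolding alg_int_iff_algebraic_int by (simp add: int_imp_algebraic_int)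

lemma alg_int_minus: "alg_int x \<Longrightarrow> alg_int (- x)"
  unfolding alg_int_iff_algebraic_int by blast

lemma alg_int_diff: "alg_int x \<Longrightarrow> alg_int y \<Longrightarrow> alg_int (x - y)"
  using alg_int_add_mult(1)[of x "- y"] alg_int_minus[of y] by simp

lemma alg_int_power: "alg_int x \<Longrightarrow> alg_int (x ^ n)"
  using alg_int_of_int[of 1] by (induction n) (auto intro: alg_int_add_mult)

lemma alg_int_of_rat_imp_Ints:
  assumes "alg_int (of_rat r)"
  shows "r \<in> \<int>"
proof -
  have "(of_rat r :: complex) \<in> \<int>"
    using rational_algebraic_int_is_int[of "of_rat r :: complex"] assms
    unfolding alg_int_iff_algebraic_int by auto
  then obtain n where "(of_rat r :: complex) = of_int n" by (elim Ints_cases)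
  then have "(of_rat r :: complex) = of_rat (of_int n)" by simp
  then have "r = of_int n" by (simp only: of_rat_eq_iff)
  then show ?thesis by simp
qed

section \<open>Determinants and discriminants\<close>

lemma det_2:
  fixes A :: "'a :: comm_ring_1 mat"
  assumes A: "A \<in> carrier_mat 2 2"
  shows "det A = A $$ (0,0) * A $$ (1,1) - A $$ (0,1) * A $$ (1,0)"
  using laplace_expansion_column[OF A, of 0] A
  by (simp add: eval_nat_numeral cofactor_def det_single mat_delete_def)

lemma det_3:
  fixes A :: "'a :: comm_ring_1 mat"
  assumes A: "A \<in> carrier_mat 3 3"
  shows "det A = A $$ (0,0) * (A $$ (1,1) * A $$ (2,2) - A $$ (1,2) * A $$ (2,1))
     - A $$ (1,0) * (A $$ (0,1) * A $$ (2,2) - A $$ (0,2) * A $$ (2,1))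
     + A $$ (2,0) * (A $$ (0,1) * A $$ (1,2) - A $$ (0,2) * A $$ (1,1))"
  using laplace_expansion_column[OF A, of 0] A
  by (simp add: eval_nat_numeral cofactor_def det_2[unfolded numeral_2_eq_2] mat_delete_def)
    (simp add: algebra_simps)

text \<open>The Laplace expansion along the first two rows; it exhibits the determinant as a scalar
  product, to which the Cauchy--Schwarz inequality can be applied.\<close>

lemma det_4:
  fixes A :: "'a :: comm_ring_1 mat"
  assumes A: "A \<in> carrier_mat 4 4"
  defines "p \<equiv> \<lambda>i j. A $$ (0,i) * A $$ (1,j) - A $$ (0,j) * A $$ (1,i)"
    and "q \<equiv> \<lambda>i j. A $$ (2,i) * A $$ (3,j) - A $$ (2,j) * A $$ (3,i)"
  shows "det A = p 0 1 * q 2 3 - p 0 2 * q 1 3 + p 0 3 * q 1 2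
     + p 1 2 * q 0 3 - p 1 3 * q 0 2 + p 2 3 * q 0 1"
  unfolding p_def q_def
  using laplace_expansion_column[OF A, of 0] A
  by (simp add: eval_nat_numeral cofactor_def det_3[unfolded numeral_3_eq_3] mat_delete_def)
    (simp add: algebra_simps)

lemma sum_lessThan_6: "(\<Sum>i<(6::nat). f i) = f 0 + f 1 + f 2 + f 3 + f 4 + f 5"
  for f :: "nat \<Rightarrow> 'a :: comm_monoid_add"
  by (simp add: eval_nat_numeral add.assoc)

lemma sum_lessThan_4: "(\<Sum>i<(4::nat). f i) = f 0 + f 1 + f 2 + f 3"
  for f :: "nat \<Rightarrow> 'a :: comm_monoid_add"
  by (simp add: eval_nat_numeral add.assoc)

text \<open>Lagrange's identity: the two sides differ by the square of the scalar product of a and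
  b.\<close>

lemma sum_minors_squared_le:
  fixes a b :: "nat \<Rightarrow> real"
  defines "p \<equiv> \<lambda>i j. a i * b j - a j * b i"
  shows "(p 0 1)\<^sup>2 + (p 0 2)\<^sup>2 + (p 0 3)\<^sup>2 + (p 1 2)\<^sup>2 + (p 1 3)\<^sup>2 + (p 2 3)\<^sup>2 \<le>
    (\<Sum>j<4. (a j)\<^sup>2) * (\<Sum>j<4. (b j)\<^sup>2)"
proof -
  have "(\<Sum>j<4. (a j)\<^sup>2) * (\<Sum>j<4. (b j)\<^sup>2) =
      (p 0 1)\<^sup>2 + (p 0 2)\<^sup>2 + (p 0 3)\<^sup>2 + (p 1 2)\<^sup>2 + (p 1 3)\<^sup>2 + (p 2 3)\<^sup>2 + (\<Sum>j<4. a j * b j)\<^sup>2"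
    unfolding p_def sum_lessThan_4 by (simp add: power2_eq_square algebra_simps)
  then show ?thesis by simp
qed

lemma hadamard_inequality_4:
  fixes A :: "real mat"
  assumes A: "A \<in> carrier_mat 4 4"
  shows "(det A)\<^sup>2 \<le> (\<Prod>i<4. \<Sum>j<4. (A $$ (i,j))\<^sup>2)"
proof -
  define p where "p = (\<lambda>i j. A $$ (0,i) * A $$ (1,j) - A $$ (0,j) * A $$ (1,i))"
  define q where "q = (\<lambda>i j. A $$ (2,i) * A $$ (3,j) - A $$ (2,j) * A $$ (3,i))"
  \<comment> \<open>Entry i of \<open>u\<close> and entry i of \<open>v\<close> are complementary
    minors; the signs of the expansion are moved into \<open>v\<close>, where squaring removes
    them.\<close>
  define u where "u = (!) [p 0 1, p 0 2, p 0 3, p 1 2, p 1 3, p 2 3]"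
  define v where "v = (!) [q 2 3, - q 1 3, q 1 2, q 0 3, - q 0 2, q 0 1]"
  have "det A = p 0 1 * q 2 3 - p 0 2 * q 1 3 + p 0 3 * q 1 2
     + p 1 2 * q 0 3 - p 1 3 * q 0 2 + p 2 3 * q 0 1"
    unfolding p_def q_def by (rule det_4[OF A])
  then have "det A = (\<Sum>i<6. u i * v i)"
    unfolding sum_lessThan_6 u_def v_def by simp
  then have "(det A)\<^sup>2 \<le> (\<Sum>i<6. (u i)\<^sup>2) * (\<Sum>i<6. (v i)\<^sup>2)"
    using Cauchy_Schwarz_ineq_sum[of u v "{..<6}"] by simp
  also have "\<dots> \<le> ((\<Sum>j<4. (A $$ (0,j))\<^sup>2) * (\<Sum>j<4. (A $$ (1,j))\<^sup>2)) *
      ((\<Sum>j<4. (A $$ (2,j))\<^sup>2) * (\<Sum>j<4. (A $$ (3,j))\<^sup>2))"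
  proof (intro mult_mono)
    show "(\<Sum>i<6. (u i)\<^sup>2) \<le> (\<Sum>j<4. (A $$ (0,j))\<^sup>2) * (\<Sum>j<4. (A $$ (1,j))\<^sup>2)"
      using sum_minors_squared_le[of "\<lambda>j. A $$ (0,j)" "\<lambda>j. A $$ (1,j)"]
      unfolding sum_lessThan_6 u_def p_def by (simp del: minus_diff_eq)
    show "(\<Sum>i<6. (v i)\<^sup>2) \<le> (\<Sum>j<4. (A $$ (2,j))\<^sup>2) * (\<Sum>j<4. (A $$ (3,j))\<^sup>2)"
      using sum_minors_squared_le[of "\<lambda>j. A $$ (2,j)" "\<lambda>j. A $$ (3,j)"]
      unfolding sum_lessThan_6 v_def q_def by (simp del: minus_diff_eq)
  qed (auto intro!: sum_nonneg mult_nonneg_nonneg)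
  also have "\<dots> = (\<Prod>i<4. \<Sum>j<4. (A $$ (i,j))\<^sup>2)"
    by (simp add: eval_nat_numeral mult.assoc)
  finally show ?thesis .
qed

lemma det_vandermonde_4:
  fixes x :: "nat \<Rightarrow> 'a :: comm_ring_1"
  shows "det (mat 4 4 (\<lambda>(i, j). x i ^ j)) =
    (x 1 - x 0) * (x 2 - x 0) * (x 3 - x 0) * (x 2 - x 1) * (x 3 - x 1) * (x 3 - x 2)"
  by (subst det_4) (simp_all add: power2_eq_square power3_eq_cube algebra_simps)

lemma det_vandermonde_4_squared_le:
  fixes x :: "nat \<Rightarrow> real"
  shows "(det (mat 4 4 (\<lambda>(i, j). x i ^ j)))\<^sup>2 \<le> 256 * (\<Prod>i<4. max 1 \<bar>x i\<bar>) ^ 6"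
proof -
  let ?V = "mat 4 4 (\<lambda>(i, j). x i ^ j)"
  have "(det ?V)\<^sup>2 \<le> (\<Prod>i<4. \<Sum>j<4. (?V $$ (i,j))\<^sup>2)"
    by (rule hadamard_inequality_4) simp
  \<comment> \<open>The exponent 6 is twice the largest column index 3; the four factors 4 give
    256.\<close>
  also have "\<dots> \<le> (\<Prod>i<4. 4 * max 1 \<bar>x i\<bar> ^ 6)"
  proof (intro prod_mono conjI)
    fix i :: nat assume i: "i \<in> {..<4}"
    have "(?V $$ (i,j))\<^sup>2 \<le> max 1 \<bar>x i\<bar> ^ 6" if "j < 4" for j
    proof -
      have "(?V $$ (i,j))\<^sup>2 = \<bar>x i\<bar> ^ (j * 2)" using i that by (simp add: power_mult flip: power_abs)
      also have "\<dots> \<le> max 1 \<bar>x i\<bar> ^ (j * 2)" by (intro power_mono) auto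
      also have "\<dots> \<le> max 1 \<bar>x i\<bar> ^ 6" using that by (intro power_increasing) auto
      finally show ?thesis .
    qed
    then have "(\<Sum>j<4. (?V $$ (i,j))\<^sup>2) \<le> (\<Sum>j<(4::nat). max 1 \<bar>x i\<bar> ^ 6)"
      by (intro sum_mono) auto
    then show "(\<Sum>j<4. (?V $$ (i,j))\<^sup>2) \<le> 4 * max 1 \<bar>x i\<bar> ^ 6" by simp
  qed (auto intro: sum_nonneg)
  also have "\<dots> = 256 * (\<Prod>i<4. max 1 \<bar>x i\<bar>) ^ 6"
    by (simp add: eval_nat_numeral prod.distrib power_mult_distrib)
  finally show ?thesis .
qed

section \<open>Subfields of the complex numbers and their embeddings\<close>

lemma is_subfield_minus:
  assumes "is_subfield K" "x \<in> K"
  shows "- x \<in> K"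
proof -
  have "0 - x \<in> K" using assms unfolding is_subfield_def by blast
  then show ?thesis by simp
qed

lemma is_subfield_of_int:
  assumes "is_subfield K"
  shows "of_int n \<in> K"
proof -
  have "of_nat i \<in> K" for i
    using assms unfolding is_subfield_def by (induction i) auto
  then show ?thesis using is_subfield_minus[OF assms] by (cases n rule: int_cases2) auto
qed

lemma is_subfield_sum:
  "is_subfield K \<Longrightarrow> (\<And>i. i \<in> I \<Longrightarrow> f i \<in> K) \<Longrightarrow> sum f I \<in> K"
  by (induction I rule: infinite_finite_induct) (auto simp: is_subfield_def)

lemma embedding_add: "embedding K \<sigma> \<Longrightarrow> x \<in> K \<Longrightarrow> y \<in> K \<Longrightarrow> \<sigma> (x + y) = \<sigma> x + \<sigma> y"
  and embedding_mult: "embedding K \<sigma> \<Longrightarrow> x \<in> K \<Longrightarrow> y \<in> K \<Longrightarrow> \<sigma> (x * y) = \<sigma> x * \<sigma> y"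
  unfolding embedding_def by blast+

lemma embedding_0:
  assumes "is_subfield K" "embedding K \<sigma>"
  shows "\<sigma> 0 = 0"
  using embedding_add[OF assms(2), of 0 0] assms(1) unfolding is_subfield_def by auto

lemma embedding_minus:
  assumes "is_subfield K" "embedding K \<sigma>" "x \<in> K"
  shows "\<sigma> (- x) = - \<sigma> x"
proof -
  have "- x \<in> K" using assms(1,3) by (rule is_subfield_minus)
  then have "\<sigma> (x + - x) = \<sigma> x + \<sigma> (- x)" using embedding_add assms(2,3) by blast
  then show ?thesis using embedding_0[OF assms(1,2)] by (simp add: eq_neg_iff_add_eq_0 add.commute)
qed

lemma embedding_of_int:
  assumes "is_subfield K" "embedding K \<sigma>"
  shows "\<sigma> (of_int n) = of_int n"
proof -
  have nat: "\<sigma> (of_nat i) = of_nat i" for i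
  proof (induction i)
    case (Suc i)
    have "\<sigma> (1 + of_nat i) = \<sigma> 1 + \<sigma> (of_nat i)"
      using is_subfield_of_int[OF assms(1), of "int i"] is_subfield_of_int[OF assms(1), of 1]
      by (intro embedding_add[OF assms(2)]) auto
    then show ?case using Suc assms(2) by (simp add: embedding_def)
  qed (simp add: embedding_0[OF assms])
  show ?thesis
    using nat embedding_minus[OF assms, of "of_nat (nat (- n))"] is_subfield_of_int[OF assms(1), of "int (nat (- n))"]
    by (cases n rule: int_cases2) auto
qed

lemma embedding_sum:
  assumes "is_subfield K" "embedding K \<sigma>" "\<And>i. i \<in> I \<Longrightarrow> f i \<in> K"
  shows "\<sigma> (sum f I) = (\<Sum>i\<in>I. \<sigma> (f i))"
  using assms(3)
proof (induction I rule: infinite_finite_induct)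
  case (insert i I)
  have "\<sigma> (f i + sum f I) = \<sigma> (f i) + \<sigma> (sum f I)"
    using insert.prems by (intro embedding_add[OF assms(2)] is_subfield_sum[OF assms(1)]) auto
  then show ?case using insert by simp
qed (auto simp: embedding_0[OF assms(1,2)])

lemma embedding_int_combination:
  assumes "is_subfield K" "embedding K \<sigma>" "\<And>i. i \<in> I \<Longrightarrow> f i \<in> K"
  shows "\<sigma> (\<Sum>i\<in>I. of_int (c i) * f i) = (\<Sum>i\<in>I. of_int (c i) * \<sigma> (f i))"
proof -
  have "\<sigma> (\<Sum>i\<in>I. of_int (c i) * f i) = (\<Sum>i\<in>I. \<sigma> (of_int (c i) * f i))"
    using assms(1,3) is_subfield_of_int[OF assms(1)]
    by (intro embedding_sum[OF assms(1,2)]) (auto simp: is_subfield_def)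
  also have "\<dots> = (\<Sum>i\<in>I. of_int (c i) * \<sigma> (f i))"
    using assms(3) is_subfield_of_int[OF assms(1)]
    by (intro sum.cong refl) (simp add: embedding_mult[OF assms(2)] embedding_of_int[OF assms(1,2)])
  finally show ?thesis .
qed

section \<open>The trace form and the discriminant\<close>

definition trace_matrix :: "complex set \<Rightarrow> nat \<Rightarrow> (nat \<Rightarrow> complex) \<Rightarrow> complex mat" where
  "trace_matrix K n b = mat n n (\<lambda>(i, j). field_trace K (b i * b j))"

lemma trace_matrix_change_of_basis:
  fixes P :: "nat \<Rightarrow> nat \<Rightarrow> int"
  assumes K: "is_subfield K" and e: "\<And>i. i < n \<Longrightarrow> e i \<in> K"
    and b: "\<And>i. i < n \<Longrightarrow> b i = (\<Sum>j<n. of_int (P i j) * e j)"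
  shows "det (trace_matrix K n b) =
    of_int (det (mat n n (\<lambda>(i, j). P i j))) ^ 2 * det (trace_matrix K n e)"
proof -
  define Q where "Q = mat n n (\<lambda>(i, j). P i j)"
  define R :: "complex mat" where "R = map_mat of_int Q"
  have [simp]: "Q \<in> carrier_mat n n" "R \<in> carrier_mat n n" "trace_matrix K n e \<in> carrier_mat n n"
    by (auto simp: Q_def R_def trace_matrix_def)
  have bK: "b i \<in> K" if "i < n" for i
    unfolding b[OF that] using K e is_subfield_of_int[OF K]
    by (intro is_subfield_sum[OF K]) (auto simp: is_subfield_def)
  have tr: "field_trace K (b i * b j) =
      (\<Sum>k<n. \<Sum>l<n. of_int (P i k) * of_int (P j l) * field_trace K (e k * e l))"
    if ij: "i < n" "j < n" for i j
  proof -
    have "\<sigma> (b i * b j) = (\<Sum>k<n. \<Sum>l<n. of_int (P i k) * of_int (P j l) * \<sigma> (e k * e l))"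
      if \<sigma>: "embedding K \<sigma>" for \<sigma>
    proof -
      have "\<sigma> (b i) = (\<Sum>k<n. of_int (P i k) * \<sigma> (e k))" if "i < n" for i
        unfolding b[OF that] using e by (intro embedding_int_combination[OF K \<sigma>]) auto
      then have "\<sigma> (b i * b j) =
          (\<Sum>k<n. of_int (P i k) * \<sigma> (e k)) * (\<Sum>l<n. of_int (P j l) * \<sigma> (e l))"
        using ij bK by (simp add: embedding_mult[OF \<sigma>])
      then show ?thesis
        using e by (simp add: sum_product embedding_mult[OF \<sigma>] algebra_simps)
    qed
    then have "field_trace K (b i * b j) = (\<Sum>\<sigma>\<in>{\<sigma>. embedding K \<sigma>}.
        \<Sum>k<n. \<Sum>l<n. of_int (P i k) * of_int (P j l) * \<sigma> (e k * e l))"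
      unfolding field_trace_def by simp
    also have "\<dots> = (\<Sum>k<n. \<Sum>\<sigma>\<in>{\<sigma>. embedding K \<sigma>}. \<Sum>l<n. of_int (P i k) * of_int (P j l) * \<sigma> (e k * e l))"
      by (rule sum.swap)
    also have "\<dots> = (\<Sum>k<n. \<Sum>l<n. \<Sum>\<sigma>\<in>{\<sigma>. embedding K \<sigma>}. of_int (P i k) * of_int (P j l) * \<sigma> (e k * e l))"
      by (intro sum.cong refl sum.swap)
    finally show ?thesis by (simp add: field_trace_def sum_distrib_left)
  qed
  have "trace_matrix K n b = R * trace_matrix K n e * transpose_mat R"
  proof (rule eq_matI)
    fix i j assume "i < dim_row (R * trace_matrix K n e * transpose_mat R)"
      "j < dim_col (R * trace_matrix K n e * transpose_mat R)"
    then have ij: "i < n" "j < n" by (auto simp: R_def Q_def)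
    have "(R * trace_matrix K n e * transpose_mat R) $$ (i, j) =
       (\<Sum>l<n. (\<Sum>k<n. of_int (P i k) * field_trace K (e k * e l)) * of_int (P j l))"
      using ij by (simp add: R_def Q_def trace_matrix_def scalar_prod_def lessThan_atLeast0)
    also have "\<dots> = field_trace K (b i * b j)"
      unfolding tr[OF ij] sum_distrib_right by (subst sum.swap) (simp add: algebra_simps)
    finally show "trace_matrix K n b $$ (i, j) = (R * trace_matrix K n e * transpose_mat R) $$ (i, j)"
      using ij by (simp add: trace_matrix_def)
  qed (auto simp: trace_matrix_def R_def Q_def)
  then have "det (trace_matrix K n b) = det R * det (trace_matrix K n e) * det (transpose_mat R)"
    using det_mult[OF mult_carrier_mat[of R n n "trace_matrix K n e" n], of "transpose_mat R"]
      det_mult[of R n "trace_matrix K n e"] by simp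
  also have "det (transpose_mat R) = det R" by (rule det_transpose[of R n]) simp
  also have "det R = of_int (det Q)" unfolding R_def by simp
  finally show ?thesis unfolding Q_def by (simp add: power2_eq_square)
qed

lemma integral_basis_expansion:
  assumes "integral_basis K n e" "\<And>i. i < n' \<Longrightarrow> b i \<in> ring_of_integers K"
  shows "\<exists>P :: nat \<Rightarrow> nat \<Rightarrow> int. \<forall>i<n'. b i = (\<Sum>j<n. of_int (P i j) * e j)"
proof -
  have "\<forall>i. \<exists>c :: nat \<Rightarrow> int. i < n' \<longrightarrow> b i = (\<Sum>j<n. of_int (c j) * e j)"
    using assms unfolding integral_basis_def by blast
  then show ?thesis unfolding choice_iff by blast
qed

lemma integral_basis_coeff_unique:
  assumes "integral_basis K n e" "i < n"
    "e i = (\<Sum>j<n. of_int (c j) * e j)" "j < n"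
  shows "c j = (if i = j then 1 else 0)"
proof -
  have "(\<Sum>j<n. of_int (c j - (if i = j then 1 else 0)) * e j) = 0"
  proof -
    have "(\<Sum>j<n. of_int (if i = j then 1 else 0) * e j) = (\<Sum>j<n. if i = j then e j else 0)"
      by (intro sum.cong) auto
    then show ?thesis using assms(2,3) by (simp only: of_int_diff left_diff_distrib sum_subtractf) simp
  qed
  moreover have "(\<Sum>j<n. of_int (d j) * e j) = 0 \<Longrightarrow> \<forall>j<n. d j = 0" for d
    using assms(1) unfolding integral_basis_def by blast
  ultimately have "c j - (if i = j then 1 else 0) = 0" using assms(4) by fast
  then show ?thesis by simp
qed

text \<open>Shows that the definite description in \<open>abs_disc\<close> is well defined: two
  integral bases are related by mutually inverse integer matrices, so they have equal length and the
  squared determinant of the change of basis is 1.\<close>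

lemma abs_disc_eq:
  assumes K: "is_subfield K" and e: "integral_basis K n e"
  shows "abs_disc K = cmod (det (trace_matrix K n e))"
  unfolding abs_disc_def
proof (rule the_equality)
  show "\<exists>n' b. integral_basis K n' b \<and> cmod (det (trace_matrix K n e)) =
      cmod (det (mat n' n' (\<lambda>(i, j). field_trace K (b i * b j))))"
    using e unfolding trace_matrix_def by blast
next
  fix d assume "\<exists>n b. integral_basis K n b \<and>
      d = cmod (det (mat n n (\<lambda>(i, j). field_trace K (b i * b j))))"
  then obtain n' b where b: "integral_basis K n' b" and d: "d = cmod (det (trace_matrix K n' b))"
    unfolding trace_matrix_def by blast
  have eO: "e i \<in> ring_of_integers K" if "i < n" for i using e that unfolding integral_basis_def by blast
  have bO: "b i \<in> ring_of_integers K" if "i < n'" for i using b that unfolding integral_basis_def by blast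
  obtain P :: "nat \<Rightarrow> nat \<Rightarrow> int" where "\<forall>i<n'. b i = (\<Sum>j<n. of_int (P i j) * e j)"
    using integral_basis_expansion[OF e, of n' b] bO by blast
  then have P: "b i = (\<Sum>j<n. of_int (P i j) * e j)" if "i < n'" for i using that by blast
  obtain Q :: "nat \<Rightarrow> nat \<Rightarrow> int" where "\<forall>i<n. e i = (\<Sum>j<n'. of_int (Q i j) * b j)"
    using integral_basis_expansion[OF b, of n e] eO by blast
  then have Q: "e i = (\<Sum>j<n'. of_int (Q i j) * b j)" if "i < n" for i using that by blast
  have QP: "(\<Sum>j<n'. Q i j * P j l) = (if i = l then 1 else 0)" if il: "i < n" "l < n" for i l
  proof -
    have "e i = (\<Sum>j<n'. \<Sum>l<n. of_int (Q i j) * (of_int (P j l) * e l))"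
      using Q[OF il(1)] P by (simp add: sum_distrib_left)
    also have "\<dots> = (\<Sum>l<n. of_int (\<Sum>j<n'. Q i j * P j l) * e l)"
      by (subst sum.swap) (simp add: sum_distrib_right mult.assoc)
    finally show ?thesis using integral_basis_coeff_unique[OF e il(1) _ il(2), of "\<lambda>l. \<Sum>j<n'. Q i j * P j l"] by blast
  qed
  have PQ: "(\<Sum>j<n. P i j * Q j l) = (if i = l then 1 else 0)" if il: "i < n'" "l < n'" for i l
  proof -
    have "b i = (\<Sum>j<n. \<Sum>l<n'. of_int (P i j) * (of_int (Q j l) * b l))"
      using P[OF il(1)] Q by (simp add: sum_distrib_left)
    also have "\<dots> = (\<Sum>l<n'. of_int (\<Sum>j<n. P i j * Q j l) * b l)"
      by (subst sum.swap) (simp add: sum_distrib_right mult.assoc)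
    finally show ?thesis using integral_basis_coeff_unique[OF b il(1) _ il(2), of "\<lambda>l. \<Sum>j<n. P i j * Q j l"] by blast
  qed
  \<comment> \<open>The traces of the identity matrices QP and PQ agree.\<close>
  have "int n = (\<Sum>i<n. \<Sum>j<n'. Q i j * P j i)" using QP by simp
  also have "\<dots> = (\<Sum>j<n'. \<Sum>i<n. P j i * Q i j)" by (subst sum.swap) (simp add: mult.commute)
  also have "\<dots> = int n'" using PQ by simp
  finally have n: "n' = n" by simp
  define p where "p = mat n n (\<lambda>(i, j). P i j)"
  define q where "q = mat n n (\<lambda>(i, j). Q i j)"
  have "p * q = 1\<^sub>m n"
    using PQ n by (intro eq_matI) (auto simp: p_def q_def scalar_prod_def lessThan_atLeast0)
  then have "det p * det q = 1"
    using det_mult[of p n q] by (simp add: p_def q_def)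
  then have "(det p)\<^sup>2 = 1" using zmult_eq_1_iff by fastforce
  then have "(of_int (det p) :: complex) ^ 2 = 1" by (simp flip: of_int_power)
  moreover have "det (trace_matrix K n b) = of_int (det p) ^ 2 * det (trace_matrix K n e)"
    unfolding p_def using eO P n by (intro trace_matrix_change_of_basis K) (auto simp: ring_of_integers_def)
  ultimately show "d = cmod (det (trace_matrix K n e))" using d n by simp
qed

text \<open>The two discriminants differ by the factor d^2 for an integer d, and d is nonzero since
  the discriminant of x is.\<close>

lemma abs_disc_le:
  assumes K: "is_subfield K" and e: "integral_basis K n e"
    and x: "\<And>i. i < n \<Longrightarrow> x i \<in> ring_of_integers K" and nz: "det (trace_matrix K n x) \<noteq> 0"
  shows "abs_disc K \<le> cmod (det (trace_matrix K n x))"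
proof -
  obtain P :: "nat \<Rightarrow> nat \<Rightarrow> int" where "\<forall>i<n. x i = (\<Sum>j<n. of_int (P i j) * e j)"
    using integral_basis_expansion[OF e, of n x] x by blast
  then have P: "x i = (\<Sum>j<n. of_int (P i j) * e j)" if "i < n" for i using that by blast
  define d where "d = det (mat n n (\<lambda>(i, j). P i j))"
  have eq: "det (trace_matrix K n x) = of_int d ^ 2 * det (trace_matrix K n e)"
    unfolding d_def using e P
    by (intro trace_matrix_change_of_basis K) (auto simp: ring_of_integers_def integral_basis_def)
  then have "d \<noteq> 0" using nz by auto
  then have "\<bar>real_of_int d\<bar> \<ge> 1" by linarith
  then have "\<bar>real_of_int d\<bar> ^ 2 \<ge> 1" by (rule one_le_power)
  then have "cmod (of_int d ^ 2) \<ge> 1" by (simp add: norm_power)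
  then show ?thesis
    unfolding eq norm_mult abs_disc_eq[OF K e] by (simp add: mult_le_cancel_right1)
qed

section \<open>The quartic field\<close>

text \<open>A rational square root of k^2 + 1 is an algebraic integer, hence an integer, but k^2 <
  k^2 + 1 < (k + 1)^2. The homogeneous form fits the norm equations below without division.\<close>

lemma nonsquare_square_plus_1:
  fixes r q :: rat
  assumes "k > 0" "r\<^sup>2 = (of_nat k ^ 2 + 1) * q\<^sup>2"
  shows "q = 0"
proof (rule ccontr)
  assume q: "q \<noteq> 0"
  define x where "x = \<bar>r / q\<bar>"
  have x2: "x\<^sup>2 = of_nat (k\<^sup>2 + 1)" using assms(2) q by (simp add: x_def power_divide)
  have "(of_rat x :: real)\<^sup>2 = of_rat (x\<^sup>2)" by (simp add: of_rat_power)
  also have "\<dots> = real (k\<^sup>2 + 1)" unfolding x2 by (rule of_rat_of_nat_eq)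
  finally have "of_rat x = sqrt (real (k\<^sup>2 + 1))"
    by (intro real_sqrt_unique[symmetric]) (auto simp: x_def)
  moreover have "algebraic_int (sqrt (real (k\<^sup>2 + 1)))"
    by (intro algebraic_int_sqrt int_imp_algebraic_int) (rule Ints_of_nat)
  ultimately have "algebraic_int (of_rat x :: real)" by simp
  then have "(of_rat x :: real) \<in> \<int>"
    by (intro rational_algebraic_int_is_int) simp_all
  then obtain n where n: "(of_rat x :: real) = of_int n" by (elim Ints_cases)
  then have "(of_int (n\<^sup>2) :: real) = of_int (int (k\<^sup>2 + 1))"
    using \<open>(of_rat x :: real)\<^sup>2 = of_rat (x\<^sup>2)\<close> \<open>of_rat (x\<^sup>2) = real (k\<^sup>2 + 1)\<close> by simp
  then have n2: "n\<^sup>2 = int (k\<^sup>2 + 1)" by (simp only: of_int_eq_iff)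
  have "(0::real) \<le> of_rat x" by (simp add: x_def)
  then have n0: "n \<ge> 0" unfolding n by simp
  have "int k < n" using n2 n0 by (intro power_less_imp_less_base[of "int k" 2]) auto
  then have "(int k + 1)\<^sup>2 \<le> n\<^sup>2" by (intro power_mono) auto
  then show False using assms(1) unfolding n2 by (simp add: power2_eq_square algebra_simps)
qed

text \<open>For r = a / b in lowest terms, b^2 divides m. It is through this lemma that
  squarefreeness bounds the denominators of algebraic integers in K.\<close>

lemma squarefree_mult_square_Ints:
  fixes r :: rat
  assumes "squarefree m" "of_nat m * r\<^sup>2 \<in> \<int>"
  shows "r \<in> \<int>"
proof -
  obtain a b where ab: "quotient_of r = (a, b)" by (cases "quotient_of r")
  have b: "b > 0" and cop: "coprime a b" and r: "r = of_int a / of_int b"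
    using quotient_of_denom_pos[OF ab] quotient_of_coprime[OF ab] quotient_of_div[OF ab] by auto
  obtain n where n: "of_nat m * r\<^sup>2 = of_int n" using assms(2) by (elim Ints_cases)
  have "(of_int (int m * a\<^sup>2) :: rat) = of_int (n * b\<^sup>2)"
    using n b by (simp add: r power_divide field_simps)
  then have "int m * a\<^sup>2 = n * b\<^sup>2" by (simp only: of_int_eq_iff)
  then have "b\<^sup>2 dvd int m * a\<^sup>2" by simp
  moreover have "coprime (b\<^sup>2) (a\<^sup>2)" using cop by (simp add: coprime_commute)
  ultimately have "b\<^sup>2 dvd int m" by (simp add: coprime_dvd_mult_left_iff)
  then have "(nat b)\<^sup>2 dvd m" using b by (metis int_dvd_int_iff int_nat_eq of_nat_power order_less_imp_le)
  then have "nat b = 1" using assms(1) unfolding squarefree_def by simp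
  then have "b = 1" using b by simp
  then show ?thesis using r by simp
qed

text \<open>The coordinates (a, b, c, d) stand for a + b s + c t + d u.\<close>

type_synonym quad = "rat \<times> rat \<times> rat \<times> rat"

locale quartic =
  fixes k :: nat
  assumes k_pos: "k > 0" and squarefree: "squarefree (k\<^sup>2 + 1)"
begin

section \<open>The nested square roots and their conjugates\<close>

definition s :: real where "s = sqrt (real k ^ 2 + 1)"
definition t :: real where "t = sqrt (real k ^ 2 + 1 + s)"
definition u :: real where "u = sqrt (real k ^ 2 + 1 - s)"

lemma s_bounds: "1 < s" "real k < s" "s < real k ^ 2 + 1"
proof -
  show "1 < s" unfolding s_def using k_pos by simp
  show "real k < s" unfolding s_def by (rule real_less_rsqrt) simp
  have "s * 1 < s * s" using \<open>1 < s\<close> by (intro mult_strict_left_mono) auto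
  also have "s * s = real k ^ 2 + 1" unfolding s_def by simp
  finally show "s < real k ^ 2 + 1" by simp
qed

lemma s_square: "s\<^sup>2 = real k ^ 2 + 1" unfolding s_def by simp

lemma t_square: "t\<^sup>2 = real k ^ 2 + 1 + s"
  and u_square: "u\<^sup>2 = real k ^ 2 + 1 - s"
  and t_pos: "t > 0" and u_pos: "u > 0" and u_less_t: "u < t"
  unfolding t_def u_def using s_bounds by (auto intro: add_nonneg_nonneg add_pos_pos)

lemma t_u: "t * u = real k * s"
proof -
  have "(t * u)\<^sup>2 = (real k * s)\<^sup>2"
    unfolding power_mult_distrib t_square u_square
    using s_square by (simp add: algebra_simps power2_eq_square)
  moreover have "0 \<le> t * u" using t_pos u_pos by simp
  moreover have "0 \<le> real k * s" using s_bounds(1) by simp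
  ultimately show ?thesis by (rule power2_eq_imp_eq)
qed

text \<open>The index j is the exponent of the Galois generator s -> -s, t -> u, u -> -t. The sign
  in the image of u is forced by t u = k s.\<close>

definition cs :: "nat \<Rightarrow> real" where "cs j = [s, - s, s, - s] ! j"
definition ct :: "nat \<Rightarrow> real" where "ct j = [t, u, - t, - u] ! j"
definition cu :: "nat \<Rightarrow> real" where "cu j = [u, - t, - u, t] ! j"

text \<open>Turns statements about a conjugate index into a check of the four table entries.\<close>

lemma less_4_cases: "j < (4::nat) \<longleftrightarrow> j = 0 \<or> j = 1 \<or> j = 2 \<or> j = 3" by auto

lemma
  assumes j: "j < 4"
  shows cs_cs: "cs j * cs j = real k ^ 2 + 1"
    and ct_ct: "ct j * ct j = real k ^ 2 + 1 + cs j"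
    and cu_cu: "cu j * cu j = real k ^ 2 + 1 - cs j"
    and ct_cu: "ct j * cu j = real k * cs j"
    and cs_ct: "cs j * ct j = ct j + real k * cu j"
    and cs_cu: "cs j * cu j = real k * ct j - cu j"
proof -
  show *: "cs j * cs j = real k ^ 2 + 1" "ct j * ct j = real k ^ 2 + 1 + cs j"
    "cu j * cu j = real k ^ 2 + 1 - cs j" "ct j * cu j = real k * cs j"
    using j s_square t_square u_square t_u unfolding less_4_cases
    by (auto simp: cs_def ct_def cu_def power2_eq_square mult.commute)
  have nz: "ct j \<noteq> 0" "cu j \<noteq> 0"
    using j t_pos u_pos unfolding less_4_cases by (auto simp: ct_def cu_def)
  \<comment> \<open>The products of s with t and u are reduced to those already known by multiplying
    with the nonzero \<open>ct j\<close> or \<open>cu j\<close> and cancelling it.\<close>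
  have "ct j * (cs j * ct j) = cs j * (ct j * ct j)" by simp
  also have "\<dots> = ct j * (ct j + real k * cu j)"
    using *(1,2,4) by (simp add: algebra_simps power2_eq_square)
  finally show "cs j * ct j = ct j + real k * cu j" using nz by simp
  have "cu j * (cs j * cu j) = cs j * (cu j * cu j)" by simp
  also have "\<dots> = cu j * (real k * ct j - cu j)"
    unfolding right_diff_distrib mult.left_commute[of "cu j" "real k"] mult.commute[of "cu j" "ct j"] *(3,4)
    by (simp add: *(1) algebra_simps power2_eq_square)
  finally show "cs j * cu j = real k * ct j - cu j" using nz by simp
qed

section \<open>Coordinate arithmetic in K\<close>

fun cj :: "nat \<Rightarrow> quad \<Rightarrow> real" where
  "cj j (a, b, c, d) = of_rat a + of_rat b * cs j + of_rat c * ct j + of_rat d * cu j"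

fun qadd :: "quad \<Rightarrow> quad \<Rightarrow> quad" where
  "qadd (a, b, c, d) (a', b', c', d') = (a + a', b + b', c + c', d + d')"

fun qscale :: "rat \<Rightarrow> quad \<Rightarrow> quad" where
  "qscale r (a, b, c, d) = (r * a, r * b, r * c, r * d)"

text \<open>The product in the basis 1, s, t, u, read off from \<open>cs_cs\<close> to
  \<open>cs_cu\<close>, whose form does not depend on j.\<close>

fun qmult :: "quad \<Rightarrow> quad \<Rightarrow> quad" where
  "qmult (a, b, c, d) (a', b', c', d') =
    (a * a' + (of_nat k ^ 2 + 1) * (b * b' + c * c' + d * d'),
     a * b' + b * a' + c * c' - d * d' + of_nat k * (c * d' + d * c'),
     a * c' + c * a' + b * c' + c * b' + of_nat k * (b * d' + d * b'),
     a * d' + d * a' + of_nat k * (b * c' + c * b') - (b * d' + d * b'))"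

lemma cj_add: "cj j (qadd x y) = cj j x + cj j y"
  by (cases x; cases y) (simp add: of_rat_add algebra_simps)

lemma cj_scale: "cj j (qscale r x) = of_rat r * cj j x"
  by (cases x) (simp add: of_rat_mult algebra_simps)

lemma cj_mult:
  assumes "j < 4"
  shows "cj j (qmult x y) = cj j x * cj j y"
proof -
  obtain a b c d where x: "x = (a, b, c, d)" by (cases x)
  obtain a' b' c' d' where y: "y = (a', b', c', d')" by (cases y)
  \<comment> \<open>Expanded over arbitrary reals, so that each product of two of S, T, U is
    isolated and can be rewritten by the multiplication table.\<close>
  have *: "(A + B * S + C * T + E * U) * (A' + B' * S + C' * T + E' * U) =
      A * A' + (A * B' + B * A') * S + (A * C' + C * A') * T + (A * E' + E * A') * U
      + B * B' * (S * S) + C * C' * (T * T) + E * E' * (U * U)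
      + (B * C' + C * B') * (S * T) + (B * E' + E * B') * (S * U) + (C * E' + E * C') * (T * U)"
    for A B C E A' B' C' E' S T U :: real by (simp add: algebra_simps)
  show ?thesis
    unfolding x y qmult.simps cj.simps *
      cs_cs[OF assms] ct_ct[OF assms] cu_cu[OF assms] cs_ct[OF assms] cs_cu[OF assms] ct_cu[OF assms]
    by (simp add: of_rat_add of_rat_mult of_rat_diff of_rat_power algebra_simps)
qed

lemma rat_combination_cs_eq_0:
  fixes p q :: rat
  assumes j: "j < 4" and eq: "of_rat p + of_rat q * cs j = 0"
  shows "p = 0" "q = 0"
proof -
  have "(of_rat q * cs j)\<^sup>2 = (of_rat p)\<^sup>2"
    using eq by (simp add: add_eq_0_iff2)
  then have "of_rat p ^ 2 = of_rat q ^ 2 * (cs j * cs j)"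
    by (simp add: power2_eq_square algebra_simps)
  then have "(of_rat (p\<^sup>2) :: real) = of_rat ((of_nat k ^ 2 + 1) * q\<^sup>2)"
    unfolding cs_cs[OF j] by (simp add: of_rat_mult of_rat_add of_rat_power)
  then have "p\<^sup>2 = (of_nat k ^ 2 + 1) * q\<^sup>2" by (simp only: of_rat_eq_iff)
  then show "q = 0" using nonsquare_square_plus_1 k_pos by blast
  then show "p = 0" using eq by simp
qed

text \<open>Squaring \<open>a + b s = - (c t + d u)\<close> and taking norms to the rationals turns a linear relation
  into \<open>(a\<^sup>2 - m b\<^sup>2)\<^sup>2 = m (k (c\<^sup>2 - d\<^sup>2) - 2 c d)\<^sup>2\<close> with \<open>m = k\<^sup>2 + 1\<close>.\<close>

lemma cj_eq_0:
  assumes j: "j < 4" and eq: "cj j (a, b, c, d) = 0"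
  shows "(a, b, c, d) = (0, 0, 0, 0)"
proof -
  let ?m = "of_nat k ^ 2 + 1 :: rat"
  let ?p = "a\<^sup>2 + ?m * b\<^sup>2 - ?m * (c\<^sup>2 + d\<^sup>2)"
  let ?q = "2 * a * b - (c\<^sup>2 - d\<^sup>2 + 2 * of_nat k * c * d)"
  have "cj j (qmult (a, b, 0, 0) (a, b, 0, 0)) = cj j (qmult (0, 0, c, d) (0, 0, c, d))"
  proof -
    have "cj j (a, b, 0, 0) = - cj j (0, 0, c, d)" using eq by simp
    then show ?thesis unfolding cj_mult[OF j] by (simp del: cj.simps)
  qed
  moreover have "of_rat ?p + of_rat ?q * cs j =
      cj j (qmult (a, b, 0, 0) (a, b, 0, 0)) - cj j (qmult (0, 0, c, d) (0, 0, c, d))"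
    by (simp add: of_rat_add of_rat_mult of_rat_diff power2_eq_square distrib_left distrib_right
      left_diff_distrib right_diff_distrib)
  ultimately have "of_rat ?p + of_rat ?q * cs j = 0" by simp
  then have pq: "?p = 0" "?q = 0" using rat_combination_cs_eq_0[OF j] by blast+
  have "(a\<^sup>2 - ?m * b\<^sup>2)\<^sup>2 = (a\<^sup>2 + ?m * b\<^sup>2)\<^sup>2 - ?m * (2 * a * b)\<^sup>2"
    by (simp add: algebra_simps power2_eq_square)
  also have "\<dots> = (?m * (c\<^sup>2 + d\<^sup>2))\<^sup>2 - ?m * (c\<^sup>2 - d\<^sup>2 + 2 * of_nat k * c * d)\<^sup>2"
    using pq by simp
  \<comment> \<open>Brahmagupta's identity (1 + k^2) (X^2 + Y^2) = (X + k Y)^2 + (k X - Y)^2 with X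
    = c^2 - d^2 and Y = 2 c d, for which X^2 + Y^2 = (c^2 + d^2)^2.\<close>
  also have "\<dots> = ?m * (of_nat k * (c\<^sup>2 - d\<^sup>2) - 2 * c * d)\<^sup>2"
    by (simp add: algebra_simps power2_eq_square)
  finally have eq2: "(a\<^sup>2 - ?m * b\<^sup>2)\<^sup>2 = ?m * (of_nat k * (c\<^sup>2 - d\<^sup>2) - 2 * c * d)\<^sup>2" .
  then have "of_nat k * (c\<^sup>2 - d\<^sup>2) - 2 * c * d = 0"
    using nonsquare_square_plus_1 k_pos by blast
  then have "(a\<^sup>2 - ?m * b\<^sup>2)\<^sup>2 = 0" unfolding eq2 by simp
  then have "a\<^sup>2 = ?m * b\<^sup>2" by simp
  then have b: "b = 0" using nonsquare_square_plus_1 k_pos by blast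
  then have a: "a = 0" using \<open>a\<^sup>2 = ?m * b\<^sup>2\<close> by simp
  have "?m * (c\<^sup>2 + d\<^sup>2) = 0" using pq(1) a b by simp
  moreover have "?m > 0" by (intro add_nonneg_pos) auto
  ultimately have "c\<^sup>2 + d\<^sup>2 = 0" by simp
  then show ?thesis using a b by (simp add: sum_power2_eq_zero_iff)
qed

lemma cj_inj:
  assumes j: "j < 4" and eq: "cj j x = cj j y"
  shows "x = y"
proof -
  obtain a b c d where x: "x = (a, b, c, d)" by (cases x)
  obtain a' b' c' d' where y: "y = (a', b', c', d')" by (cases y)
  have "cj j (a - a', b - b', c - c', d - d') = 0"
    using eq unfolding x y by (simp add: of_rat_diff algebra_simps)
  from cj_eq_0[OF j this] show ?thesis unfolding x y by simp
qed

end

section \<open>Embeddings, rational numbers and integer polynomials\<close>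

lemma is_subfield_of_rat:
  assumes "is_subfield K"
  shows "of_rat r \<in> K"
proof -
  obtain a b where ab: "quotient_of r = (a, b)" by (cases "quotient_of r")
  have b: "b > 0" and r: "r = of_int a / of_int b"
    using quotient_of_denom_pos[OF ab] quotient_of_div[OF ab] by auto
  have "inverse (of_int b) \<in> K"
    using is_subfield_of_int[OF assms, of b] assms b unfolding is_subfield_def by auto
  then have "of_int a * inverse (of_int b) \<in> K"
    using is_subfield_of_int[OF assms, of a] assms unfolding is_subfield_def by blast
  then show ?thesis unfolding r of_rat_divide by (simp add: divide_inverse)
qed

lemma embedding_inverse:
  assumes "is_subfield K" "embedding K \<sigma>" "x \<in> K"
  shows "\<sigma> (inverse x) = inverse (\<sigma> x)"
proof (cases "x = 0")
  case True
  then show ?thesis using embedding_0[OF assms(1,2)] by simp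
next
  case False
  then have "inverse x \<in> K" using assms(1,3) unfolding is_subfield_def by blast
  then have "\<sigma> x * \<sigma> (inverse x) = 1"
    using embedding_mult[OF assms(2,3), of "inverse x"] False assms(2) by (simp add: embedding_def)
  then show ?thesis by (simp add: inverse_unique)
qed

lemma embedding_of_rat:
  assumes "is_subfield K" "embedding K \<sigma>"
  shows "\<sigma> (of_rat r) = of_rat r"
proof -
  obtain a b where ab: "quotient_of r = (a, b)" by (cases "quotient_of r")
  have r: "r = of_int a / of_int b" using quotient_of_div[OF ab] .
  have bK: "of_int b \<in> K" and aK: "of_int a \<in> K" using is_subfield_of_int[OF assms(1)] by auto
  have ib: "inverse (of_int b) \<in> K"
    using is_subfield_of_rat[OF assms(1), of "inverse (of_int b)"] by (simp add: of_rat_inverse)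
  have "\<sigma> (of_int a * inverse (of_int b)) = of_int a * inverse (of_int b)"
    using embedding_mult[OF assms(2) aK ib] embedding_inverse[OF assms bK]
    by (simp add: embedding_of_int[OF assms])
  then show ?thesis unfolding r of_rat_divide by (simp add: divide_inverse)
qed

lemma embedding_poly:
  fixes p :: "int poly"
  assumes "is_subfield K" "embedding K \<sigma>" "x \<in> K"
  shows "poly (map_poly of_int p) x \<in> K \<and>
    \<sigma> (poly (map_poly of_int p) x) = poly (map_poly of_int p) (\<sigma> x)"
proof (induction p)
  case 0
  then show ?case using assms(1) embedding_0[OF assms(1,2)] by (simp add: is_subfield_def)
next
  case (pCons a p)
  let ?y = "poly (map_poly of_int p) x"
  have 1: "of_int a \<in> K" "x * ?y \<in> K"
    using is_subfield_of_int[OF assms(1)] pCons assms(1,3) unfolding is_subfield_def by auto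
  then have "of_int a + x * ?y \<in> K" using assms(1) unfolding is_subfield_def by blast
  moreover have "\<sigma> (of_int a + x * ?y) = of_int a + \<sigma> x * \<sigma> ?y"
    using 1 pCons embedding_mult[OF assms(2,3)] embedding_add[OF assms(2)]
    by (simp add: embedding_of_int[OF assms(1,2)])
  ultimately show ?case using pCons by (simp add: map_poly_pCons)
qed

lemma embedding_alg_int:
  assumes "is_subfield K" "embedding K \<sigma>" "x \<in> K" "alg_int x"
  shows "alg_int (\<sigma> x)"
proof -
  obtain p :: "int poly" where p: "lead_coeff p = 1" "poly (map_poly of_int p) x = 0"
    using assms(4) unfolding alg_int_def by blast
  then show ?thesis
    using embedding_poly[OF assms(1-3), of p] embedding_0[OF assms(1,2)] unfolding alg_int_def by auto
qed

lemma of_real_of_rat: "(of_real (of_rat r) :: complex) = of_rat r"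
proof -
  obtain a b where ab: "quotient_of r = (a, b)" by (cases "quotient_of r")
  show ?thesis unfolding quotient_of_div[OF ab] of_rat_divide by simp
qed

context quartic
begin

section \<open>The field K as the image of the coordinates\<close>

definition ev :: "quad \<Rightarrow> complex" where "ev x = complex_of_real (cj 0 x)"

lemma ev_add: "ev (qadd x y) = ev x + ev y"
  by (simp add: ev_def cj_add)

lemma ev_mult: "ev (qmult x y) = ev x * ev y"
  by (simp add: ev_def cj_mult)

lemma ev_scale: "ev (qscale r x) = of_rat r * ev x"
  by (simp add: ev_def cj_scale of_real_of_rat)

lemma ev_inj: "ev x = ev y \<Longrightarrow> x = y"
  unfolding ev_def by (rule cj_inj[of 0]) simp_all

lemma ev_altdef:
  "ev (a, b, c, d) = of_rat a + of_rat b * of_real s + of_rat c * of_real t + of_rat d * of_real u"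
  by (simp add: ev_def cs_def ct_def cu_def of_real_of_rat)

text \<open>The nontrivial automorphism of K over Q(s), the square of the Galois generator.\<close>

fun qconj :: "quad \<Rightarrow> quad" where "qconj (a, b, c, d) = (a, b, - c, - d)"

lemma qmult_qconj:
  "qmult (a, b, c, d) (qconj (a, b, c, d)) =
    (a\<^sup>2 + (of_nat k ^ 2 + 1) * (b\<^sup>2 - (c\<^sup>2 + d\<^sup>2)),
     2 * a * b - (c\<^sup>2 - d\<^sup>2 + 2 * of_nat k * c * d), 0, 0)"
  by (simp add: power2_eq_square algebra_simps)

lemma ev_0: "ev (0, 0, 0, 0) = 0" by (simp add: ev_altdef)

text \<open>The norm is taken in two stages, first down to Q(s) with \<open>qconj\<close>, then down
  to the rationals; the cofactor divided by the nonzero rational norm n is the inverse.\<close>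

lemma inverse_in_range_ev:
  assumes "ev x \<noteq> 0"
  shows "inverse (ev x) \<in> range ev"
proof -
  obtain a b c d where x: "x = (a, b, c, d)" by (cases x)
  obtain p q where pq: "qmult x (qconj x) = (p, q, 0, 0)" using qmult_qconj unfolding x by blast
  have xc: "ev (qconj x) \<noteq> 0"
  proof
    assume "ev (qconj x) = 0"
    then have "qconj x = (0, 0, 0, 0)" using ev_inj ev_0 by metis
    then have "x = (0, 0, 0, 0)" by (cases x) simp
    then show False using assms ev_0 by simp
  qed
  define n where "n = p\<^sup>2 - (of_nat k ^ 2 + 1) * q\<^sup>2"
  have n: "qmult (p, q, 0, 0) (p, - q, 0, 0) = (n, 0, 0, 0)"
    by (simp add: n_def power2_eq_square algebra_simps)
  have "n \<noteq> 0"
  proof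
    assume "n = 0"
    then have "p\<^sup>2 = (of_nat k ^ 2 + 1) * q\<^sup>2" by (simp add: n_def)
    then have "q = 0" using nonsquare_square_plus_1 k_pos by blast
    then have "p = 0" using \<open>p\<^sup>2 = _\<close> by simp
    have "ev x * ev (qconj x) = 0"
      unfolding ev_mult[symmetric] pq \<open>p = 0\<close> \<open>q = 0\<close> by (rule ev_0)
    then show False using assms xc by simp
  qed
  have "ev x * ev (qconj x) * ev (p, - q, 0, 0) = of_rat n"
    unfolding ev_mult[symmetric] pq n by (simp add: ev_altdef)
  then have "ev x * ev (qscale (1 / n) (qmult (qconj x) (p, - q, 0, 0))) = 1"
    unfolding ev_scale ev_mult using \<open>n \<noteq> 0\<close> by (simp add: of_rat_divide field_simps)
  then have "inverse (ev x) = ev (qscale (1 / n) (qmult (qconj x) (p, - q, 0, 0)))"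
    by (rule inverse_unique)
  then show ?thesis by (rule range_eqI)
qed

lemma is_subfield_range_ev: "is_subfield (range ev)"
  unfolding is_subfield_def
proof (intro conjI ballI impI)
  show "0 \<in> range ev" by (rule range_eqI[of _ _ "(0, 0, 0, 0)"]) (simp add: ev_altdef)
  show "1 \<in> range ev" by (rule range_eqI[of _ _ "(1, 0, 0, 0)"]) (simp add: ev_altdef)
  fix x assume "x \<in> range ev"
  then obtain x' where x: "x = ev x'" by blast
  show "inverse x \<in> range ev" if "x \<noteq> 0" using inverse_in_range_ev[of x'] that x by simp
  fix y assume "y \<in> range ev"
  then obtain y' where y: "y = ev y'" by blast
  show "x + y \<in> range ev" by (rule range_eqI[of _ _ "qadd x' y'"]) (simp add: x y ev_add)
  show "x - y \<in> range ev"
    by (rule range_eqI[of _ _ "qadd x' (qscale (-1) y')"]) (simp add: x y ev_add ev_scale)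
  show "x * y \<in> range ev" by (rule range_eqI[of _ _ "qmult x' y'"]) (simp add: x y ev_mult)
qed

text \<open>Kept as named images of integers, so that \<open>is_subfield_of_int\<close> and
  \<open>embedding_of_int\<close> match directly and the simplifier does not rearrange the relations
  between s, t and u.\<close>

definition kC :: complex where "kC = of_int (int k)"
definition mC :: complex where "mC = of_int (int k ^ 2 + 1)"

lemma kC_eq: "kC = of_real (real k)" and mC_eq: "mC = of_real (real k ^ 2 + 1)"
  by (simp_all add: kC_def mC_def)

lemma s_s_C: "of_real s * of_real s = mC"
  and t_t_C: "of_real t * of_real t = mC + of_real s"
  and u_u_C: "of_real u * of_real u = mC - of_real s"
  and t_u_C: "of_real t * of_real u = kC * of_real s"
  unfolding kC_eq mC_eq of_real_mult[symmetric] of_real_add[symmetric] of_real_diff[symmetric] of_real_eq_iff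
  using s_square t_square u_square t_u by (simp_all add: power2_eq_square)

text \<open>From t one recovers s = t^2 - m and then u = k s / t.\<close>

lemma ev_in_subfield:
  assumes F: "is_subfield F" and t: "of_real t \<in> F"
  shows "ev x \<in> F"
proof -
  have add: "x + y \<in> F" "x - y \<in> F" "x * y \<in> F" if "x \<in> F" "y \<in> F" for x y
    using F that unfolding is_subfield_def by blast+
  have "of_real t * of_real t - mC \<in> F"
    unfolding mC_def by (intro add t is_subfield_of_int[OF F])
  also have "of_real t * of_real t - mC = of_real s" unfolding t_t_C by simp
  finally have s: "of_real s \<in> F" .
  have "inverse (of_real t) \<in> F" using F t t_pos unfolding is_subfield_def by auto
  then have "of_real t * of_real u * inverse (of_real t) \<in> F"
    unfolding t_u_C kC_def by (intro add s is_subfield_of_int[OF F])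
  also have "of_real t * of_real u * inverse (of_real t) = (of_real u :: complex)"
    using t_pos by simp
  finally have u: "of_real u \<in> F" .
  show ?thesis
    by (cases x) (simp only: ev_altdef, intro add s t u is_subfield_of_rat[OF F])
qed

lemma of_real_s_eq_ev: "of_real s = ev (0, 1, 0, 0)"
  and of_real_t_eq_ev: "of_real t = ev (0, 0, 1, 0)"
  and of_real_u_eq_ev: "of_real u = ev (0, 0, 0, 1)"
  by (simp_all add: ev_altdef)

lemma K_field_eq: "K_field k = range ev"
proof -
  have t: "sqrt (real (k\<^sup>2 + 1) + sqrt (real (k\<^sup>2 + 1))) = t"
    by (simp add: t_def s_def add.commute)
  have "of_real t \<in> range ev" unfolding of_real_t_eq_ev by blast
  then have "QQ_adj (of_real t) \<subseteq> range ev"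
    unfolding QQ_adj_def using is_subfield_range_ev by blast
  moreover have "range ev \<subseteq> QQ_adj (of_real t)"
    unfolding QQ_adj_def using ev_in_subfield by blast
  ultimately show ?thesis unfolding K_field_def t by blast
qed

lemma is_subfield_K: "is_subfield (K_field k)"
  unfolding K_field_eq by (rule is_subfield_range_ev)

lemma ev_in_K: "ev x \<in> K_field k" unfolding K_field_eq by blast

section \<open>The four embeddings and the trace\<close>

definition emb :: "nat \<Rightarrow> complex \<Rightarrow> complex" where
  "emb j x = (if x \<in> K_field k then of_real (cj j (inv_into UNIV ev x)) else 0)"

lemma emb_ev: "emb j (ev x) = of_real (cj j x)"
proof -
  have "inj ev" using ev_inj by (rule injI)
  then show ?thesis by (simp add: emb_def ev_in_K)
qed

lemma embedding_emb:
  assumes "j < 4"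
  shows "embedding (K_field k) (emb j)"
  unfolding embedding_def
proof (intro conjI ballI allI impI)
  have "emb j (ev (1, 0, 0, 0)) = 1" unfolding emb_ev by simp
  then show "emb j 1 = 1" by (simp add: ev_altdef)
  fix x y assume "x \<in> K_field k" "y \<in> K_field k"
  then obtain x' y' where x: "x = ev x'" and y: "y = ev y'" unfolding K_field_eq by blast
  show "emb j (x + y) = emb j x + emb j y" unfolding x y ev_add[symmetric] emb_ev by (simp add: cj_add)
  show "emb j (x * y) = emb j x * emb j y"
    unfolding x y ev_mult[symmetric] emb_ev by (simp add: cj_mult[OF assms])
qed (simp add: emb_def)

text \<open>The image S of s is one of two square roots of m, the image T of t is then one of two
  square roots of m + S, and T U = k S determines the image U of u. The four outcomes are the
  entries of \<open>cs\<close>, \<open>ct\<close>, \<open>cu\<close>.\<close>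

lemma embedding_imp_emb:
  assumes \<sigma>: "embedding (K_field k) \<sigma>"
  shows "\<exists>j<4. \<sigma> = emb j"
proof -
  let ?K = "K_field k"
  define S T U where "S = \<sigma> (of_real s)" and "T = \<sigma> (of_real t)" and "U = \<sigma> (of_real u)"
  have K: "of_real s \<in> ?K" "of_real t \<in> ?K" "of_real u \<in> ?K"
    unfolding of_real_s_eq_ev of_real_t_eq_ev of_real_u_eq_ev by (rule ev_in_K)+
  have rat: "of_rat r \<in> ?K" "\<sigma> (of_rat r) = of_rat r" for r
    using is_subfield_of_rat[OF is_subfield_K] embedding_of_rat[OF is_subfield_K \<sigma>] by auto
  have int: "kC \<in> ?K" "\<sigma> kC = kC" "mC \<in> ?K" "\<sigma> mC = mC"
    using is_subfield_of_int[OF is_subfield_K] embedding_of_int[OF is_subfield_K \<sigma>]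
    by (simp_all only: kC_def mC_def)
  have add: "x + y \<in> ?K" "x * y \<in> ?K" "\<sigma> (x + y) = \<sigma> x + \<sigma> y" "\<sigma> (x * y) = \<sigma> x * \<sigma> y"
    if "x \<in> ?K" "y \<in> ?K" for x y
    using is_subfield_K that embedding_add[OF \<sigma>] embedding_mult[OF \<sigma>] unfolding is_subfield_def by blast+
  have SS: "S * S = mC"
    using add(4)[OF K(1,1)] unfolding s_s_C int S_def by simp
  have TT: "T * T = mC + S"
    using add(4)[OF K(2,2)] add(3)[OF int(3) K(1)] unfolding t_t_C int S_def T_def by simp
  have TU: "T * U = kC * S"
    using add(4)[OF K(2,3)] add(4)[OF int(1) K(1)] unfolding t_u_C int S_def T_def U_def by simp
  have "S\<^sup>2 = (of_real s)\<^sup>2" unfolding power2_eq_square SS s_s_C ..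
  then have "S = of_real s \<or> S = - of_real s" by (simp add: power2_eq_iff)
  then have "\<exists>j<4. S = of_real (cs j) \<and> T = of_real (ct j) \<and> U = of_real (cu j)"
  proof
    assume S: "S = of_real s"
    have "T\<^sup>2 = (of_real t)\<^sup>2"
      unfolding power2_eq_square TT t_t_C S ..
    then have "T = of_real t \<or> T = - of_real t" by (simp add: power2_eq_iff)
    then show ?thesis
    proof
      assume T: "T = of_real t"
      have "of_real t * U = of_real t * of_real u"
        using TU unfolding t_u_C S T .
      then have "U = of_real u" using t_pos by (simp only: mult_cancel_left) simp
      then show ?thesis using S T by (intro exI[of _ 0]) (simp add: cs_def ct_def cu_def)
    next
      assume T: "T = - of_real t"
      have "of_real t * U = of_real t * - of_real u"
        using TU unfolding S T mult_minus_right t_u_C by (simp add: neg_eq_iff_add_eq_0 eq_neg_iff_add_eq_0 add.commute)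
      then have "U = - of_real u" using t_pos by (simp only: mult_cancel_left) simp
      then show ?thesis using S T by (intro exI[of _ 2]) (simp add: cs_def ct_def cu_def)
    qed
  next
    assume S: "S = - of_real s"
    have "T\<^sup>2 = (of_real u)\<^sup>2"
      unfolding power2_eq_square TT u_u_C S by simp
    then have "T = of_real u \<or> T = - of_real u" by (simp add: power2_eq_iff)
    then show ?thesis
    proof
      assume T: "T = of_real u"
      have "of_real u * U = of_real u * - of_real t"
        using TU t_u_C unfolding S T by (simp add: mult.commute)
      then have "U = - of_real t" using u_pos by (simp only: mult_cancel_left) simp
      then show ?thesis using S T by (intro exI[of _ 1]) (simp add: cs_def ct_def cu_def)
    next
      assume T: "T = - of_real u"
      have "of_real u * U = of_real u * of_real t"
        using TU t_u_C unfolding S T by (simp add: mult.commute)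
      then have "U = of_real t" using u_pos by (simp only: mult_cancel_left) simp
      then show ?thesis using S T by (intro exI[of _ 3]) (simp add: cs_def ct_def cu_def)
    qed
  qed
  then obtain j where j: "j < 4" "S = of_real (cs j)" "T = of_real (ct j)" "U = of_real (cu j)" by blast
  have "\<sigma> x = emb j x" for x
  proof (cases "x \<in> ?K")
    case True
    then obtain a b c d where x: "x = ev (a, b, c, d)" unfolding K_field_eq by auto
    have "\<sigma> x = of_rat a + of_rat b * S + of_rat c * T + of_rat d * U"
      unfolding x ev_altdef S_def T_def U_def by (simp add: add rat K)
    also have "\<dots> = emb j x" unfolding x emb_ev j by (simp add: of_real_of_rat)
    finally show ?thesis .
  next
    case False
    then show ?thesis using \<sigma> by (simp add: embedding_def emb_def)
  qed
  then show ?thesis using j(1) by blast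
qed

text \<open>Since 0 < u < t, the values t, u, -t, -u differ. Thus t separates the embeddings, and
  the trace really has four summands.\<close>

lemma ct_inj: "i < 4 \<Longrightarrow> j < 4 \<Longrightarrow> ct i = ct j \<Longrightarrow> i = j"
  using t_pos u_pos u_less_t unfolding less_4_cases by (auto simp: ct_def)

lemma emb_inj:
  assumes "i < 4" "j < 4" "emb i (of_real t) = emb j (of_real t)"
  shows "i = j"
  using assms(3) ct_inj[OF assms(1,2)] unfolding of_real_t_eq_ev emb_ev by simp

lemma embeddings_eq: "{\<sigma>. embedding (K_field k) \<sigma>} = emb ` {..<4}"
  using embedding_emb embedding_imp_emb by auto

lemma field_trace_eq: "field_trace (K_field k) x = (\<Sum>j<4. emb j x)"
proof -
  have "inj_on emb {..<4}" using emb_inj by (intro inj_onI) (metis lessThan_iff)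
  then show ?thesis unfolding field_trace_def embeddings_eq by (simp add: sum.reindex)
qed

lemma alg_int_cj:
  assumes "alg_int (ev x)" "j < 4"
  shows "alg_int (of_real (cj j x))"
  using embedding_alg_int[OF is_subfield_K embedding_emb[OF assms(2)] ev_in_K assms(1)]
  unfolding emb_ev .

end

section \<open>The ring of integers\<close>

text \<open>Let x = (A + B s + C t + E u) / 4 with conjugate y over Q(s). Then x + y = (A + B s) /
  2, (x - y)^2 = (P + Q s) / 2 and x y = (P' + Q' s) / 2, and the three divisibilities say that
  their norms are integers. For odd k, m is twice an odd number, so 4 | X^2 - m Y^2 forces X and Y
  to be even.\<close>

lemma parity_odd_case:
  fixes k A B C E P Q P' Q' :: int
  assumes "odd k" and m: "m = k\<^sup>2 + 1"
    and h1: "4 dvd A\<^sup>2 - m * B\<^sup>2"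
    and P: "2 * P = m * (C\<^sup>2 + E\<^sup>2)" and Q: "2 * Q = C\<^sup>2 - E\<^sup>2 + 2 * k * C * E"
    and h2: "4 dvd P\<^sup>2 - m * Q\<^sup>2"
    and P': "8 * P' = A\<^sup>2 + m * B\<^sup>2 - m * (C\<^sup>2 + E\<^sup>2)"
    and Q': "8 * Q' = 2 * A * B - (C\<^sup>2 - E\<^sup>2 + 2 * k * C * E)"
    and h3: "4 dvd P'\<^sup>2 - m * Q'\<^sup>2"
  shows "4 dvd A" "4 dvd B" "4 dvd C" "4 dvd E"
proof -
  obtain l where l: "k = 2 * l + 1" using \<open>odd k\<close> by (rule oddE)
  define h where "h = 2 * (l\<^sup>2 + l) + 1"
  have mh: "m = 2 * h" and "odd h" by (simp_all add: m l h_def power2_eq_square algebra_simps)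
  obtain z1 where z1: "A\<^sup>2 - m * B\<^sup>2 = 4 * z1" using h1 by (elim dvdE)
  then have "A\<^sup>2 = 2 * (h * B\<^sup>2 + 2 * z1)" by (simp add: mh)
  then have "even (A\<^sup>2)" by simp
  then obtain A1 where A: "A = 2 * A1" by (auto elim: evenE)
  have "h * B\<^sup>2 = 2 * (A1\<^sup>2 - z1)" using z1 by (simp add: A mh power2_eq_square)
  then have "even (h * B\<^sup>2)" by simp
  then obtain B1 where B: "B = 2 * B1" using \<open>odd h\<close> by (auto elim: evenE)
  have "C\<^sup>2 - E\<^sup>2 = 2 * (Q - k * C * E)" using Q by simp
  then have "even (C\<^sup>2 - E\<^sup>2)" by simp
  then have CE: "even C = even E" by simp
  have "even C"
  proof (rule ccontr)
    \<comment> \<open>Then Q is odd and P is even, so P^2 - m Q^2 is 2 modulo 4.\<close>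
    assume "odd C"
    then obtain c e where c: "C = 2 * c + 1" and e: "E = 2 * e + 1" using CE by (meson oddE)
    have "2 * Q = 2 * (2 * (c\<^sup>2 + c - e\<^sup>2 - e) + k * C * E)"
      unfolding Q by (simp add: c e power2_eq_square algebra_simps)
    then have "Q = 2 * (c\<^sup>2 + c - e\<^sup>2 - e) + k * C * E" by simp
    then have "odd Q" using \<open>odd k\<close> c e by simp
    have "P = h * (C\<^sup>2 + E\<^sup>2)" using P by (simp add: mh)
    then have "even P" using c e by simp
    then obtain p where p: "P = 2 * p" by (rule evenE)
    obtain z where "P\<^sup>2 - m * Q\<^sup>2 = 4 * z" using h2 by (elim dvdE)
    then have "h * Q\<^sup>2 = 2 * (p\<^sup>2 - z)" by (simp add: p mh power2_eq_square)
    then have "even (h * Q\<^sup>2)" by simp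
    then show False using \<open>odd h\<close> \<open>odd Q\<close> by simp
  qed
  then obtain C1 E1 where C: "C = 2 * C1" and E: "E = 2 * E1" using CE by (meson evenE)
  \<comment> \<open>The second factor 2 comes from the norm: after halving A, B, C, E, the evenness
    of P' and Q' forces the halves to be even again.\<close>
  have P'1: "2 * P' = A1\<^sup>2 + m * (B1\<^sup>2 - C1\<^sup>2 - E1\<^sup>2)"
    using P' by (simp add: A B C E power2_eq_square algebra_simps)
  have Q'1: "2 * Q' = 2 * A1 * B1 - (C1\<^sup>2 - E1\<^sup>2 + 2 * k * C1 * E1)"
    using Q' by (simp add: A B C E power2_eq_square algebra_simps)
  obtain z where z: "P'\<^sup>2 - m * Q'\<^sup>2 = 4 * z" using h3 by (elim dvdE)
  then have "P'\<^sup>2 = 2 * (h * Q'\<^sup>2 + 2 * z)" by (simp add: mh)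
  then have "even (P'\<^sup>2)" by simp
  then obtain p where p: "P' = 2 * p" by (auto elim: evenE)
  have "h * Q'\<^sup>2 = 2 * (p\<^sup>2 - z)" using z by (simp add: p mh power2_eq_square)
  then have "even (h * Q'\<^sup>2)" by simp
  then obtain q where q: "Q' = 2 * q" using \<open>odd h\<close> by (auto elim: evenE)
  have "A1\<^sup>2 = 2 * (2 * p - h * (B1\<^sup>2 - C1\<^sup>2 - E1\<^sup>2))" using P'1 by (simp add: p mh)
  then have "even (A1\<^sup>2)" by simp
  then obtain a where a: "A1 = 2 * a" by (auto elim: evenE)
  have "h * (B1\<^sup>2 - C1\<^sup>2 - E1\<^sup>2) = 2 * (p - a\<^sup>2)" using P'1 by (simp add: p a mh power2_eq_square)
  then have "even (h * (B1\<^sup>2 - C1\<^sup>2 - E1\<^sup>2))" by simp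
  then have BCE: "even (B1\<^sup>2 - C1\<^sup>2 - E1\<^sup>2)" using \<open>odd h\<close> by simp
  have V: "C1\<^sup>2 - E1\<^sup>2 = 2 * (2 * a * B1 - k * C1 * E1 - 2 * q)" using Q'1 by (simp add: q a)
  then have "even (C1\<^sup>2 - E1\<^sup>2)" by simp
  then have CE1: "even C1 = even E1" by simp
  have "even C1"
  proof (rule ccontr)
    assume "odd C1"
    then obtain c e where c: "C1 = 2 * c + 1" and e: "E1 = 2 * e + 1" using CE1 by (meson oddE)
    have "k * C1 * E1 = 2 * (a * B1 - q - (c\<^sup>2 + c - e\<^sup>2 - e))"
      using V by (simp add: c e power2_eq_square algebra_simps)
    then have "even (k * C1 * E1)" by simp
    then show False using \<open>odd k\<close> c e by simp
  qed
  then show "4 dvd A" "4 dvd B" "4 dvd C" "4 dvd E"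
    using CE1 BCE by (auto simp: A B C E a elim!: evenE)
qed

text \<open>Same hypotheses as in the odd case, but now m is 1 modulo 4, so 4 | X^2 - m Y^2 only
  gives that X and Y have equal parity. This weaker conclusion is what admits (1 + s) / 2.\<close>

lemma parity_even_case:
  fixes k A B C E P Q P' Q' :: int
  assumes "even k" and m: "m = k\<^sup>2 + 1"
    and h1: "4 dvd A\<^sup>2 - m * B\<^sup>2"
    and P: "2 * P = m * (C\<^sup>2 + E\<^sup>2)" and Q: "2 * Q = C\<^sup>2 - E\<^sup>2 + 2 * k * C * E"
    and h2: "4 dvd P\<^sup>2 - m * Q\<^sup>2"
    and P': "8 * P' = A\<^sup>2 + m * B\<^sup>2 - m * (C\<^sup>2 + E\<^sup>2)"
    and Q': "8 * Q' = 2 * A * B - (C\<^sup>2 - E\<^sup>2 + 2 * k * C * E)"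
    and h3: "4 dvd P'\<^sup>2 - m * Q'\<^sup>2"
  shows "even A" "4 dvd A - B" "4 dvd C" "4 dvd E"
proof -
  obtain l where l: "k = 2 * l" using \<open>even k\<close> by (rule evenE)
  define h where "h = l\<^sup>2"
  have mh: "m = 4 * h + 1" by (simp add: m l h_def power2_eq_square)
  have "even (A\<^sup>2 - m * B\<^sup>2)" using h1 by (meson dvd_trans even_numeral)
  then have AB: "even A = even B" by (simp add: mh)
  have "C\<^sup>2 - E\<^sup>2 = 2 * (Q - k * C * E)" using Q by simp
  then have "even (C\<^sup>2 - E\<^sup>2)" by simp
  then have CE: "even C = even E" by simp
  have "even C"
  proof (rule ccontr)
    assume "odd C"
    then obtain c e where c: "C = 2 * c + 1" and e: "E = 2 * e + 1" using CE by (meson oddE)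
    have "2 * Q = 2 * (2 * (c\<^sup>2 + c - e\<^sup>2 - e) + k * C * E)"
      unfolding Q by (simp add: c e power2_eq_square algebra_simps)
    then have "Q = 2 * (c\<^sup>2 + c - e\<^sup>2 - e) + k * C * E" by simp
    then have "even Q" using \<open>even k\<close> by simp
    have "2 * P = 2 * (m * (2 * (c\<^sup>2 + c + e\<^sup>2 + e) + 1))"
      unfolding P by (simp add: c e power2_eq_square algebra_simps)
    then have "P = m * (2 * (c\<^sup>2 + c + e\<^sup>2 + e) + 1)" by simp
    then have "odd P" by (simp add: mh)
    have "even (P\<^sup>2 - m * Q\<^sup>2)" using h2 by (meson dvd_trans even_numeral)
    then show False using \<open>odd P\<close> \<open>even Q\<close> by simp
  qed
  then obtain C1 E1 where C: "C = 2 * C1" and E: "E = 2 * E1" using CE by (meson evenE)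
  have "A * B = 2 * (2 * Q' + (C1\<^sup>2 - E1\<^sup>2 + 2 * k * C1 * E1))"
    using Q' by (simp add: C E power2_eq_square algebra_simps)
  then have "even (A * B)" by simp
  then show "even A" using AB by auto
  then obtain A1 B1 where A: "A = 2 * A1" and B: "B = 2 * B1" using AB by (meson evenE)
  have P'1: "2 * P' = A1\<^sup>2 + m * (B1\<^sup>2 - C1\<^sup>2 - E1\<^sup>2)"
    using P' by (simp add: A B C E power2_eq_square algebra_simps)
  have Q'1: "2 * Q' = 2 * A1 * B1 - (C1\<^sup>2 - E1\<^sup>2 + 2 * k * C1 * E1)"
    using Q' by (simp add: A B C E power2_eq_square algebra_simps)
  have "even (P'\<^sup>2 - m * Q'\<^sup>2)" using h3 by (meson dvd_trans even_numeral)
  then have "even (P' - Q')" by (simp add: mh)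
  then obtain r where r: "P' - Q' = 2 * r" by (rule evenE)
  \<comment> \<open>The difference of \<open>P'1\<close> and \<open>Q'1\<close>. As k is even, it
    says that (A1 - B1)^2 is congruent to 2 E1^2 modulo 4, which makes both A1 - B1 and E1
    even.\<close>
  have "(A1 - B1)\<^sup>2 = 2 * (2 * r + E1\<^sup>2 - 2 * h * (B1\<^sup>2 - C1\<^sup>2 - E1\<^sup>2) - k * C1 * E1)"
    using P'1 Q'1 r by (simp add: mh power2_eq_square algebra_simps)
  then have "even ((A1 - B1)\<^sup>2)" by simp
  then have "even (A1 - B1)" by simp
  then obtain d where d: "A1 - B1 = 2 * d" by (rule evenE)
  have "2 * (2 * d\<^sup>2) = (A1 - B1)\<^sup>2" unfolding d by (simp add: power2_eq_square)
  then have "E1\<^sup>2 = 2 * (d\<^sup>2 - r + h * (B1\<^sup>2 - C1\<^sup>2 - E1\<^sup>2) + l * C1 * E1)"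
    unfolding \<open>(A1 - B1)\<^sup>2 = _\<close> by (simp add: l algebra_simps)
  then have "even (E1\<^sup>2)" by (rule dvdI)
  then have E1: "even E1" by simp
  have "C1\<^sup>2 - E1\<^sup>2 = 2 * (A1 * B1 - k * C1 * E1 - Q')" using Q'1 by simp
  then have "even (C1\<^sup>2 - E1\<^sup>2)" by (rule dvdI)
  then have "even C1" using E1 by simp
  then show "4 dvd C" "4 dvd E" using E1 by (auto simp: C E elim!: evenE)
  have "A - B = 4 * d" using d unfolding A B by linarith
  then show "4 dvd A - B" by simp
qed

context quartic
begin

section \<open>Integrality in terms of coordinates\<close>

lemma cj_swap: "of_real (cj 1 (p, q, 0, 0)) = ev (p, - q, 0, 0)"
  by (simp add: ev_def cs_def of_rat_minus)

lemma ev_rat: "ev (r, 0, 0, 0) = of_rat r" by (simp add: ev_altdef)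

text \<open>Trace 2 p and norm N = p^2 - m q^2 are integers, so m (2 q)^2 = (2 p)^2 - 4 N is one
  too, and squarefreeness of m makes 2 q an integer.\<close>

lemma quadratic_integer:
  assumes int: "alg_int (ev (p, q, 0, 0))"
  obtains P Q :: int where "2 * p = of_int P" "2 * q = of_int Q" "4 dvd P\<^sup>2 - (int k ^ 2 + 1) * Q\<^sup>2"
proof -
  let ?m = "of_nat k ^ 2 + 1 :: rat"
  have int': "alg_int (ev (p, - q, 0, 0))" using alg_int_cj[OF int, of 1] unfolding cj_swap by simp
  have "ev (p, q, 0, 0) + ev (p, - q, 0, 0) = of_rat (2 * p)"
    unfolding ev_add[symmetric] ev_rat[symmetric] by simp
  then have "2 * p \<in> \<int>"
    using alg_int_add_mult(1)[OF int int'] by (intro alg_int_of_rat_imp_Ints) simp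
  then obtain P where P: "2 * p = of_int P" by (elim Ints_cases)
  have "ev (p, q, 0, 0) * ev (p, - q, 0, 0) = of_rat (p\<^sup>2 - ?m * q\<^sup>2)"
    unfolding ev_mult[symmetric] ev_rat[symmetric] by (simp add: power2_eq_square algebra_simps)
  then have "p\<^sup>2 - ?m * q\<^sup>2 \<in> \<int>"
    using alg_int_add_mult(2)[OF int int'] by (intro alg_int_of_rat_imp_Ints) simp
  then obtain N where N: "p\<^sup>2 - ?m * q\<^sup>2 = of_int N" by (elim Ints_cases)
  have *: "?m * (2 * q)\<^sup>2 = (2 * p)\<^sup>2 - 4 * (p\<^sup>2 - ?m * q\<^sup>2)" by (simp add: power2_eq_square algebra_simps)
  have "of_nat (k\<^sup>2 + 1) * (2 * q)\<^sup>2 = of_int (P\<^sup>2 - 4 * N)" using * unfolding P N by (simp add: add.commute)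
  then have "of_nat (k\<^sup>2 + 1) * (2 * q)\<^sup>2 \<in> \<int>" by simp
  then have "2 * q \<in> \<int>" using squarefree_mult_square_Ints[OF squarefree] by blast
  then obtain Q where Q: "2 * q = of_int Q" by (elim Ints_cases)
  have "(of_int ((int k ^ 2 + 1) * Q\<^sup>2) :: rat) = of_int (P\<^sup>2 - 4 * N)"
    using * unfolding P Q N by simp
  then have "(int k ^ 2 + 1) * Q\<^sup>2 = P\<^sup>2 - 4 * N" by (simp only: of_int_eq_iff)
  then have "4 dvd P\<^sup>2 - (int k ^ 2 + 1) * Q\<^sup>2" by simp
  then show thesis using that P Q by blast
qed

lemma alg_int_s: "alg_int (of_real s)"
  and alg_int_t: "alg_int (of_real t)"
  and alg_int_u: "alg_int (of_real u)"
proof -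
  have root: "alg_int x" if "alg_int (x * x)" for x :: complex
    using that unfolding alg_int_iff_algebraic_int
    by (rule algebraic_int_root[of "x * x" "[:0, 0, 1:]"]) (simp_all add: coeff_pCons split: nat.splits)
  show s: "alg_int (of_real s)"
    by (rule root) (simp only: s_s_C mC_def alg_int_of_int)
  show "alg_int (of_real t)"
    by (rule root) (simp only: t_t_C mC_def alg_int_add_mult(1)[OF alg_int_of_int s])
  show "alg_int (of_real u)"
    by (rule root) (simp only: u_u_C mC_def alg_int_diff[OF alg_int_of_int s])
qed

text \<open>Applies \<open>quadratic_integer\<close> to the relative trace, the squared difference
  from the conjugate and the relative norm over Q(s); the conclusions are the hypotheses of the two
  parity lemmas.\<close>

lemma ring_of_integers_coordinates:
  assumes int: "alg_int (ev (a, b, c, d))"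
  obtains A B C E P Q P' Q' :: int
  where "4 * a = of_int A" "4 * b = of_int B" "4 * c = of_int C" "4 * d = of_int E"
    and "4 dvd A\<^sup>2 - (int k ^ 2 + 1) * B\<^sup>2"
    and "2 * P = (int k ^ 2 + 1) * (C\<^sup>2 + E\<^sup>2)" "2 * Q = C\<^sup>2 - E\<^sup>2 + 2 * int k * C * E"
    and "4 dvd P\<^sup>2 - (int k ^ 2 + 1) * Q\<^sup>2"
    and "8 * P' = A\<^sup>2 + (int k ^ 2 + 1) * B\<^sup>2 - (int k ^ 2 + 1) * (C\<^sup>2 + E\<^sup>2)"
    and "8 * Q' = 2 * A * B - (C\<^sup>2 - E\<^sup>2 + 2 * int k * C * E)"
    and "4 dvd P'\<^sup>2 - (int k ^ 2 + 1) * Q'\<^sup>2"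
proof -
  let ?m = "of_nat k ^ 2 + 1 :: rat"
  let ?V = "c\<^sup>2 - d\<^sup>2 + 2 * of_nat k * c * d"
  have "of_real (cj 2 (a, b, c, d)) = ev (a, b, - c, - d)"
    by (simp add: ev_def cs_def ct_def cu_def of_rat_minus)
  then have int': "alg_int (ev (a, b, - c, - d))" using alg_int_cj[OF int, of 2] by simp
  have "ev (a, b, c, d) + ev (a, b, - c, - d) = ev (2 * a, 2 * b, 0, 0)"
    unfolding ev_add[symmetric] by simp
  then have "alg_int (ev (2 * a, 2 * b, 0, 0))" using alg_int_add_mult(1)[OF int int'] by simp
  then obtain A B where A: "4 * a = of_int A" and B: "4 * b = of_int B"
    and h1: "4 dvd A\<^sup>2 - (int k ^ 2 + 1) * B\<^sup>2"
    by (elim quadratic_integer) simp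
  have "ev (a, b, c, d) - ev (a, b, - c, - d) = ev (0, 0, 2 * c, 2 * d)"
    by (simp add: ev_altdef of_rat_mult of_rat_minus)
  then have y: "alg_int (ev (0, 0, 2 * c, 2 * d))" using alg_int_diff[OF int int'] by simp
  \<comment> \<open>Multiplying by the integer t moves the element into Q(s) and gives a linear
    condition: 4 c + 4 k d is an integer e.\<close>
  have "ev (0, 0, 2 * c, 2 * d) * ev (0, 0, 1, 0) = ev (?m * (2 * c), 2 * c + of_nat k * (2 * d), 0, 0)"
    unfolding ev_mult[symmetric] by simp
  then have "alg_int (ev (?m * (2 * c), 2 * c + of_nat k * (2 * d), 0, 0))"
    using alg_int_add_mult(2)[OF y, of "ev (0, 0, 1, 0)"] alg_int_t unfolding of_real_t_eq_ev by simp
  then obtain e :: int where e: "2 * (2 * c + of_nat k * (2 * d)) = of_int e"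
    by (elim quadratic_integer)
  have "ev (0, 0, 2 * c, 2 * d) * ev (0, 0, 2 * c, 2 * d) = ev (4 * ?m * (c\<^sup>2 + d\<^sup>2), 4 * ?V, 0, 0)"
    unfolding ev_mult[symmetric] by (simp add: power2_eq_square algebra_simps)
  then have "alg_int (ev (4 * ?m * (c\<^sup>2 + d\<^sup>2), 4 * ?V, 0, 0))"
    using alg_int_add_mult(2)[OF y y] by simp
  then obtain P Q where P: "2 * (4 * ?m * (c\<^sup>2 + d\<^sup>2)) = of_int P" and Q: "2 * (4 * ?V) = of_int Q"
    and h2: "4 dvd P\<^sup>2 - (int k ^ 2 + 1) * Q\<^sup>2"
    by (elim quadratic_integer)
  \<comment> \<open>Completing the square in c^2 - d^2 + 2 k c d leaves m d^2, so squarefreeness of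
    m applies to 4 d alone.\<close>
  have "?m * (4 * d)\<^sup>2 = (2 * (2 * c + of_nat k * (2 * d)))\<^sup>2 - 2 * (2 * (4 * ?V))"
    by (simp add: power2_eq_square algebra_simps)
  also have "\<dots> = of_int (e\<^sup>2 - 2 * Q)" unfolding e Q by simp
  finally have "of_nat (k\<^sup>2 + 1) * (4 * d)\<^sup>2 \<in> \<int>" by (simp add: add.commute)
  then have "4 * d \<in> \<int>" using squarefree_mult_square_Ints[OF squarefree] by blast
  then obtain E where E: "4 * d = of_int E" by (elim Ints_cases)
  have "4 * c = of_int (e - int k * E)" using e E[symmetric] by (simp add: algebra_simps)
  then obtain C where C: "4 * c = of_int C" by blast
  have "ev (a, b, c, d) * ev (a, b, - c, - d) =
      ev (a\<^sup>2 + ?m * (b\<^sup>2 - (c\<^sup>2 + d\<^sup>2)), 2 * a * b - ?V, 0, 0)"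
    unfolding ev_mult[symmetric] qmult_qconj[symmetric] by simp
  then have "alg_int (ev (a\<^sup>2 + ?m * (b\<^sup>2 - (c\<^sup>2 + d\<^sup>2)), 2 * a * b - ?V, 0, 0))"
    using alg_int_add_mult(2)[OF int int'] by simp
  then obtain P' Q' where P': "2 * (a\<^sup>2 + ?m * (b\<^sup>2 - (c\<^sup>2 + d\<^sup>2))) = of_int P'"
    and Q': "2 * (2 * a * b - ?V) = of_int Q'" and h3: "4 dvd P'\<^sup>2 - (int k ^ 2 + 1) * Q'\<^sup>2"
    by (elim quadratic_integer)
  have CC: "16 * c\<^sup>2 = of_int (C\<^sup>2)" "16 * d\<^sup>2 = of_int (E\<^sup>2)" "16 * (c * d) = of_int (C * E)"
    "16 * a\<^sup>2 = of_int (A\<^sup>2)" "16 * b\<^sup>2 = of_int (B\<^sup>2)" "16 * (a * b) = of_int (A * B)"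
    unfolding of_int_power of_int_mult A[symmetric] B[symmetric] C[symmetric] E[symmetric]
    by (simp_all add: power2_eq_square)
  have "(of_int (2 * P) :: rat) = ?m * (16 * c\<^sup>2 + 16 * d\<^sup>2)"
    unfolding of_int_mult P[symmetric] by (simp add: algebra_simps)
  also have "\<dots> = of_int ((int k ^ 2 + 1) * (C\<^sup>2 + E\<^sup>2))" unfolding CC by simp
  finally have 1: "2 * P = (int k ^ 2 + 1) * (C\<^sup>2 + E\<^sup>2)" by (simp only: of_int_eq_iff)
  have "(of_int (2 * Q) :: rat) = 16 * c\<^sup>2 - 16 * d\<^sup>2 + 2 * of_nat k * (16 * (c * d))"
    unfolding of_int_mult Q[symmetric] by (simp add: algebra_simps)
  also have "\<dots> = of_int (C\<^sup>2 - E\<^sup>2 + 2 * int k * C * E)" unfolding CC by simp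
  finally have 2: "2 * Q = C\<^sup>2 - E\<^sup>2 + 2 * int k * C * E" by (simp only: of_int_eq_iff)
  have "(of_int (8 * P') :: rat) = 16 * a\<^sup>2 + ?m * (16 * b\<^sup>2) - ?m * (16 * c\<^sup>2 + 16 * d\<^sup>2)"
    unfolding of_int_mult P'[symmetric] by (simp add: algebra_simps)
  also have "\<dots> = of_int (A\<^sup>2 + (int k ^ 2 + 1) * B\<^sup>2 - (int k ^ 2 + 1) * (C\<^sup>2 + E\<^sup>2))"
    unfolding CC by simp
  finally have 3: "8 * P' = A\<^sup>2 + (int k ^ 2 + 1) * B\<^sup>2 - (int k ^ 2 + 1) * (C\<^sup>2 + E\<^sup>2)"
    by (simp only: of_int_eq_iff)
  have "(of_int (8 * Q') :: rat) =
      2 * (16 * (a * b)) - (16 * c\<^sup>2 - 16 * d\<^sup>2 + 2 * of_nat k * (16 * (c * d)))"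
    unfolding of_int_mult Q'[symmetric] by (simp add: algebra_simps)
  also have "\<dots> = of_int (2 * A * B - (C\<^sup>2 - E\<^sup>2 + 2 * int k * C * E))" unfolding CC by simp
  finally have 4: "8 * Q' = 2 * A * B - (C\<^sup>2 - E\<^sup>2 + 2 * int k * C * E)" by (simp only: of_int_eq_iff)
  show thesis by (rule that[OF A B C E h1 1 2 h2 3 4 h3])
qed

section \<open>Integral basis and discriminant of K\<close>

definition basis :: "nat \<Rightarrow> quad" where
  "basis i = [(1, 0, 0, 0), if odd k then (0, 1, 0, 0) else (1/2, 1/2, 0, 0),
     (0, 0, 1, 0), (0, 0, 0, 1)] ! i"

lemma alg_int_half_one_plus_s:
  assumes "even k"
  shows "alg_int (ev (1/2, 1/2, 0, 0))"
proof -
  obtain l where l: "k = 2 * l" using assms by (rule evenE)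
  define x where "x = ev (1/2, 1/2, 0, 0)"
  have "x * x = ev (qmult (1/2, 1/2, 0, 0) (1/2, 1/2, 0, 0))" by (simp only: x_def ev_mult)
  also have "\<dots> = ev (qadd (1/2, 1/2, 0, 0) (of_int (int l ^ 2), 0, 0, 0))"
  proof -
    have "(of_nat k :: rat)\<^sup>2 = 4 * of_int (int l ^ 2)" by (simp add: l power_mult_distrib)
    then show ?thesis by (simp add: add_divide_distrib)
  qed
  also have "\<dots> = x + of_int (int l ^ 2)" by (simp only: ev_add ev_rat x_def of_rat_of_int_eq)
  finally have *: "x * x = x + of_int (int l ^ 2)" .
  have "poly (map_poly of_int [:- (int l ^ 2), - 1, 1:]) x = 0"
    using * by (simp add: map_poly_pCons algebra_simps)
  then show ?thesis unfolding alg_int_def x_def by (intro exI[of _ "[:- (int l ^ 2), - 1, 1:]"]) simp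
qed

lemma alg_int_basis: "i < 4 \<Longrightarrow> alg_int (ev (basis i))"
  unfolding less_4_cases using alg_int_s alg_int_t alg_int_u alg_int_half_one_plus_s alg_int_of_int[of 1]
  unfolding of_real_s_eq_ev of_real_t_eq_ev of_real_u_eq_ev
  by (auto simp: basis_def ev_rat)

lemma int_combination_basis:
  "(\<Sum>i<4. of_int (c i) * ev (basis i)) =
    ev (if odd k then (of_int (c 0), of_int (c 1), of_int (c 2), of_int (c 3))
      else (of_int (c 0) + of_int (c 1) / 2, of_int (c 1) / 2, of_int (c 2), of_int (c 3)))"
  unfolding sum_lessThan_4
  by (simp add: basis_def ev_altdef of_rat_add of_rat_mult of_rat_divide field_simps)

lemma ring_of_integers_span:
  assumes "x \<in> ring_of_integers (K_field k)"
  shows "\<exists>c. x = (\<Sum>i<4. of_int (c i) * ev (basis i))"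
proof -
  obtain a b c d where x: "x = ev (a, b, c, d)"
    using assms unfolding ring_of_integers_def K_field_eq by auto
  have int: "alg_int (ev (a, b, c, d))" using assms x unfolding ring_of_integers_def by auto
  obtain A B C E P Q P' Q' :: int
    where ABCE: "4 * a = of_int A" "4 * b = of_int B" "4 * c = of_int C" "4 * d = of_int E"
      and h: "4 dvd A\<^sup>2 - (int k ^ 2 + 1) * B\<^sup>2"
      "2 * P = (int k ^ 2 + 1) * (C\<^sup>2 + E\<^sup>2)" "2 * Q = C\<^sup>2 - E\<^sup>2 + 2 * int k * C * E"
      "4 dvd P\<^sup>2 - (int k ^ 2 + 1) * Q\<^sup>2"
      "8 * P' = A\<^sup>2 + (int k ^ 2 + 1) * B\<^sup>2 - (int k ^ 2 + 1) * (C\<^sup>2 + E\<^sup>2)"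
      "8 * Q' = 2 * A * B - (C\<^sup>2 - E\<^sup>2 + 2 * int k * C * E)"
      "4 dvd P'\<^sup>2 - (int k ^ 2 + 1) * Q'\<^sup>2"
    using ring_of_integers_coordinates[OF int] .
  have quarter: "r = of_int n" if "4 * r = of_int (4 * n)" for r :: rat and n using that by simp
  show ?thesis
  proof (cases "odd k")
    case True
    then have "odd (int k)" by simp
    note dvd = parity_odd_case[OF this refl h]
    obtain A' where A': "A = 4 * A'" using dvd(1) by (elim dvdE)
    obtain B' where B': "B = 4 * B'" using dvd(2) by (elim dvdE)
    obtain C' where C': "C = 4 * C'" using dvd(3) by (elim dvdE)
    obtain E' where E': "E = 4 * E'" using dvd(4) by (elim dvdE)
    have "a = of_int A'" "b = of_int B'" "c = of_int C'" "d = of_int E'"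
      using ABCE unfolding A' B' C' E' by (auto intro: quarter)
    then show ?thesis
      unfolding x int_combination_basis using True by (intro exI[of _ "(!) [A', B', C', E']"]) simp
  next
    case False
    then have "even (int k)" by simp
    note dvd = parity_even_case[OF this refl h]
    obtain A' where A': "A - B = 4 * A'" using dvd(2) by (elim dvdE)
    obtain C' where C': "C = 4 * C'" using dvd(3) by (elim dvdE)
    obtain E' where E': "E = 4 * E'" using dvd(4) by (elim dvdE)
    have "even B" using dvd(1) A' by presburger
    then obtain B' where B': "B = 2 * B'" by (elim evenE)
    have A: "A = 4 * A' + 2 * B'" using A' B' by simp
    have a: "a = of_int A' + of_int B' / 2" using ABCE(1) unfolding A by simp
    have b: "b = of_int B' / 2" using ABCE(2) unfolding B' by simp
    have cd: "c = of_int C'" "d = of_int E'" using ABCE unfolding C' E' by (auto intro: quarter)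
    show ?thesis
      unfolding x int_combination_basis a b cd using False by (intro exI[of _ "(!) [A', B', C', E']"]) simp
  qed
qed

lemma integral_basis_K: "integral_basis (K_field k) 4 (\<lambda>i. ev (basis i))"
  unfolding integral_basis_def
proof (intro conjI allI ballI impI)
  fix i :: nat assume "i < 4"
  then show "ev (basis i) \<in> ring_of_integers (K_field k)"
    using alg_int_basis ev_in_K unfolding ring_of_integers_def by simp
next
  fix x assume "x \<in> ring_of_integers (K_field k)"
  then show "\<exists>c. x = (\<Sum>i<4. of_int (c i) * ev (basis i))" by (rule ring_of_integers_span)
next
  fix c :: "nat \<Rightarrow> int" and i :: nat
  assume "(\<Sum>i<4. of_int (c i) * ev (basis i)) = 0" and i: "i < 4"
  then have "(if odd k then (of_int (c 0), of_int (c 1), of_int (c 2), of_int (c 3))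
      else (of_int (c 0) + of_int (c 1) / 2, of_int (c 1) / 2, of_int (c 2), of_int (c 3))) =
      (0 :: rat, 0 :: rat, 0 :: rat, 0 :: rat)"
    unfolding int_combination_basis ev_0[symmetric] by (blast dest: ev_inj)
  then have "c 0 = 0" "c 1 = 0" "c 2 = 0" "c 3 = 0" by (auto split: if_splits)
  then show "c i = 0" using i unfolding less_4_cases by auto
qed

lemma field_trace_ev: "field_trace (K_field k) (ev (a, b, c, d)) = of_rat (4 * a)"
  unfolding field_trace_eq sum_lessThan_4 emb_ev
  by (simp add: cs_def ct_def cu_def of_real_of_rat of_rat_mult)

text \<open>On 1, s, t, u the trace form is diagonal with entries 4, 4 m, 4 m, 4 m. Replacing s by
  (1 + s) / 2 enlarges the lattice with index 2 and divides the determinant by 4.\<close>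

lemma abs_disc_K: "abs_disc (K_field k) = (if odd k then 256 else 64) * (real k ^ 2 + 1) ^ 3"
proof -
  define T where "T = trace_matrix (K_field k) 4 (\<lambda>i. ev (basis i))"
  have T: "T $$ (i, j) = of_rat (4 * fst (qmult (basis i) (basis j)))" if "i < 4" "j < 4" for i j
    using that field_trace_ev
    by (cases "qmult (basis i) (basis j)") (simp add: T_def trace_matrix_def ev_mult[symmetric])
  have car: "T \<in> carrier_mat 4 4" by (simp add: T_def trace_matrix_def)
  have "det T = of_real ((if odd k then 256 else 64) * (real k ^ 2 + 1) ^ 3)"
    unfolding det_4[OF car]
    by (simp add: T basis_def of_rat_add of_rat_mult of_rat_divide of_rat_power power3_eq_cube)
      (simp add: algebra_simps)
  then have "cmod (det T) = \<bar>(if odd k then 256 else 64) * (real k ^ 2 + 1) ^ 3\<bar>"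
    by (simp only: norm_of_real)
  then show ?thesis unfolding abs_disc_eq[OF is_subfield_K integral_basis_K] T_def by simp
qed

end

section \<open>Minimal polynomials and Mahler measures\<close>

lemma degree_map_poly_of_int: "degree (map_poly (of_int :: int \<Rightarrow> complex) p) = degree p"
  by (rule degree_map_poly) simp

text \<open>If p factors, the factor vanishing at \<alpha> already has full degree, so the other is
  a constant dividing the leading coefficient 1.\<close>

lemma min_int_poly_eqI:
  fixes p :: "int poly"
  assumes monic: "lead_coeff p = 1" and deg: "degree p > 0"
    and root: "poly (map_poly of_int p) \<alpha> = 0"
    and min: "\<And>g :: int poly. poly (map_poly of_int g) \<alpha> = 0 \<Longrightarrow> g \<noteq> 0 \<Longrightarrow> degree p \<le> degree g"
  shows "min_int_poly \<alpha> = p"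
proof -
  have p0: "p \<noteq> 0" using deg by auto
  have unit: "b dvd 1" if "p = a * b" "poly (map_poly of_int a) \<alpha> = 0" for a b :: "int poly"
  proof -
    have ab: "a \<noteq> 0" "b \<noteq> 0" using that p0 by auto
    then have "degree p = degree a + degree b" using that by (simp add: degree_mult_eq)
    moreover have "degree p \<le> degree a" using min that ab by blast
    ultimately have "degree b = 0" by simp
    then obtain c where c: "b = [:c:]" by (rule degree_eq_zeroE)
    have "lead_coeff a * lead_coeff b = 1" using monic that(1) by (simp add: lead_coeff_mult)
    then have "lead_coeff a * c = 1" by (simp add: c)
    then have "c dvd 1" by (metis dvd_triv_right)
    then show ?thesis unfolding c by (simp add: is_unit_const_poly_iff)
  qed
  have hom: "poly (map_poly of_int (a * b)) \<alpha> = poly (map_poly of_int a) \<alpha> * poly (map_poly of_int b) \<alpha>"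
    for a b :: "int poly" by (simp add: of_int_poly_hom.hom_mult)
  have not_unit: "\<not> p dvd 1" using deg by (auto simp: is_unit_poly_iff)
  have "irreducible p"
  proof (rule irreducibleI)
    fix a b assume ab: "p = a * b"
    then have "poly (map_poly of_int a) \<alpha> = 0 \<or> poly (map_poly of_int b) \<alpha> = 0"
      using root hom by simp
    then show "a dvd 1 \<or> b dvd 1" using unit[of a b] unit[of b a] ab by (auto simp: mult.commute)
  qed (use p0 not_unit in auto)
  show ?thesis
    unfolding min_int_poly_def
  proof (rule the_equality)
    show "irreducible p \<and> lead_coeff p > 0 \<and> poly (map_poly of_int p) \<alpha> = 0"
      using \<open>irreducible p\<close> monic root by simp
    fix g :: "int poly"
    assume g: "irreducible g \<and> lead_coeff g > 0 \<and> poly (map_poly of_int g) \<alpha> = 0"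
    \<comment> \<open>As p is monic, the scaling factor of pseudo-division is 1 and this is ordinary
      division over the integers.\<close>
    obtain q r where qr: "pseudo_divmod g p = (q, r)" by (cases "pseudo_divmod g p")
    have eq: "g = p * q + r" and r: "r = 0 \<or> degree r < degree p"
      using pseudo_divmod[OF p0 qr] monic by simp_all
    have "poly (map_poly of_int r) \<alpha> = 0"
      using g root unfolding eq by (simp add: of_int_poly_hom.hom_add hom)
    then have "r = 0" using r min[of r] by fastforce
    then have gpq: "g = p * q" using eq by simp
    then have "q dvd 1" using g not_unit irreducibleD by blast
    then obtain c where c: "q = [:c:]" "c dvd 1" by (auto simp: is_unit_poly_iff)
    have "lead_coeff g = lead_coeff p * lead_coeff q" unfolding gpq by (rule lead_coeff_mult)
    then have "c > 0" using g c(1) monic by simp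
    then have "c = 1" using c(2) by simp
    then show "g = p" using gpq c by simp
  qed
qed

lemma mahler_prod_linear:
  fixes X :: "nat \<Rightarrow> complex"
  assumes inj: "inj_on X {..<n}"
  shows "mahler (\<Prod>j<n. [:- X j, 1:]) = (\<Prod>j<n. max 1 (cmod (X j)))"
proof -
  let ?f = "\<Prod>j<n. [:- X j, 1:]"
  have roots: "{z. poly ?f z = 0} = X ` {..<n}" by (auto simp: poly_prod)
  have "lead_coeff ?f = 1" by (simp add: lead_coeff_prod)
  moreover have "Polynomial.order (X j) ?f = 1" if j: "j < n" for j
  proof -
    define g where "g = (\<Prod>i\<in>{..<n} - {j}. [:- X i, 1:])"
    have f: "?f = [:- X j, 1:] * g" unfolding g_def using j by (subst prod.remove[of _ j]) auto
    have "poly g (X j) \<noteq> 0"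
      unfolding g_def poly_prod using inj j by (auto simp: inj_on_def)
    then have "Polynomial.order (X j) g = 0" and "g \<noteq> 0" by (auto simp: order_0I)
    have "[:- X j, 1:] * g \<noteq> 0" using \<open>g \<noteq> 0\<close> by (simp only: mult_eq_0_iff) simp
    from Polynomial.order_mult[OF this] show ?thesis
      unfolding f using \<open>Polynomial.order (X j) g = 0\<close> order_power_n_n[of "X j" 1] by (simp only: power_one_right)
  qed
  ultimately show ?thesis
    unfolding mahler_def roots by (simp add: prod.reindex[OF inj])
qed

section \<open>Conjugates of an integral generator\<close>

context quartic
begin

text \<open>The conjugates are paired as 0, 2 and 1, 3. Sum and product of each pair lie in Q(s),
  and s -> -s exchanges the pairs, so the s-terms cancel in the coefficients. These are thus
  rational algebraic integers.\<close>

lemma char_poly_int: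
  assumes int: "alg_int (ev x)"
  obtains p :: "int poly" where "lead_coeff p = 1" "degree p = 4"
    "map_poly of_int p = (\<Prod>j<4. [:- complex_of_real (cj j x), 1:])"
proof -
  obtain a b c d where x: "x = (a, b, c, d)" by (cases x)
  obtain p q where pq: "qmult x (qconj x) = (p, q, 0, 0)" using qmult_qconj unfolding x by blast
  define X where "X = (\<lambda>j. complex_of_real (cj j x))"
  have X: "alg_int (X j)" if "j < 4" for j unfolding X_def by (rule alg_int_cj[OF int that])
  let ?S = "complex_of_real s"
  let ?m = "of_nat k ^ 2 + 1 :: rat"
  have SS: "?S * ?S = of_rat ?m" unfolding s_s_C mC_def by (simp add: of_rat_add of_rat_power)
  have 02: "X 0 + X 2 = of_rat (2 * a) + of_rat (2 * b) * ?S"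
    and 13: "X 1 + X 3 = of_rat (2 * a) - of_rat (2 * b) * ?S"
    by (simp_all add: X_def x cs_def ct_def cu_def of_real_of_rat of_rat_mult algebra_simps)
  have conj: "cj 2 x = cj 0 (qconj x)" "cj 3 x = cj 1 (qconj x)"
    by (simp_all add: x cs_def ct_def cu_def of_rat_minus)
  have m02: "X 0 * X 2 = of_rat p + of_rat q * ?S" and m13: "X 1 * X 3 = of_rat p - of_rat q * ?S"
  proof -
    have "cj j (qmult x (qconj x)) = cj j x * cj j (qconj x)" if "j < 4" for j by (rule cj_mult[OF that])
    then have "complex_of_real (cj j x) * of_real (cj j (qconj x)) = of_real (cj j (p, q, 0, 0))"
      if "j < 4" for j using that by (metis pq of_real_mult)
    from this[of 0] this[of 1]
    show "X 0 * X 2 = of_rat p + of_rat q * ?S" "X 1 * X 3 = of_rat p - of_rat q * ?S"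
      unfolding X_def conj by (simp_all add: cs_def of_real_of_rat)
  qed
  define c0 c1 c2 c3 where "c0 = (X 0 * X 2) * (X 1 * X 3)"
    and "c1 = - ((X 0 * X 2) * (X 1 + X 3) + (X 0 + X 2) * (X 1 * X 3))"
    and "c2 = X 0 * X 2 + X 1 * X 3 + (X 0 + X 2) * (X 1 + X 3)"
    and "c3 = - ((X 0 + X 2) + (X 1 + X 3))"
  have alg: "alg_int c0" "alg_int c1" "alg_int c2" "alg_int c3"
    unfolding c0_def c1_def c2_def c3_def by (intro alg_int_minus alg_int_add_mult X; simp)+
  have *: "(P + Q * S) * (A - B * S) = P * A - Q * B * (S * S) + (Q * A - P * B) * S"
    "(A + B * S) * (P - Q * S) = P * A - Q * B * (S * S) - (Q * A - P * B) * S"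
    for P Q A B S :: complex by (simp_all add: algebra_simps)
  have "c0 = of_rat (p * p - q * q * ?m)"
    unfolding c0_def m02 m13 * SS by (simp add: of_rat_diff of_rat_mult)
  moreover have "c1 = of_rat (- (2 * (p * (2 * a) - q * (2 * b) * ?m)))"
    unfolding c1_def m02 m13 02 13 * SS by (simp add: of_rat_diff of_rat_mult of_rat_minus) (simp add: algebra_simps)
  moreover have "c2 = of_rat (2 * p + (2 * a * (2 * a) - 2 * b * (2 * b) * ?m))"
    unfolding c2_def m02 m13 02 13 * SS by (simp add: of_rat_diff of_rat_mult of_rat_add)
  moreover have "c3 = of_rat (- (4 * a))"
    unfolding c3_def 02 13 by (simp add: of_rat_mult of_rat_minus)
  moreover have "\<exists>n. of_rat r = (of_int n :: complex)" if "alg_int (of_rat r)" for r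
    using alg_int_of_rat_imp_Ints[OF that] by (auto elim!: Ints_cases)
  ultimately obtain n0 n1 n2 n3
    where n: "c0 = of_int n0" "c1 = of_int n1" "c2 = of_int n2" "c3 = of_int n3"
    using alg by metis
  define f where "f = [:n0, n1, n2, n3, 1:]"
  have "map_poly of_int f = [:c0, c1, c2, c3, 1:]" by (simp add: f_def map_poly_pCons n)
  also have "\<dots> = (\<Prod>j<4. [:- X j, 1:])"
    by (simp add: eval_nat_numeral c0_def c1_def c2_def c3_def algebra_simps)
  finally have "map_poly of_int f = (\<Prod>j<4. [:- complex_of_real (cj j x), 1:])" unfolding X_def .
  then show thesis by (intro that[of f]) (simp_all add: f_def)
qed

text \<open>The elements on which two embeddings agree form a subfield. If it contains a generator
  it is all of K, and t tells the embeddings apart.\<close>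

lemma conjugates_distinct:
  assumes "QQ_adj (ev x) = K_field k"
  shows "inj_on (\<lambda>j. cj j x) {..<4}"
proof (rule inj_onI)
  fix i j :: nat assume ij: "i \<in> {..<4}" "j \<in> {..<4}" and eq: "cj i x = cj j x"
  let ?K = "K_field k"
  have emb: "embedding ?K (emb i)" "embedding ?K (emb j)" using ij embedding_emb by auto
  define F where "F = {y \<in> ?K. emb i y = emb j y}"
  have sub: "is_subfield F"
    unfolding is_subfield_def
  proof (intro conjI ballI impI)
    show "0 \<in> F" "1 \<in> F"
      using is_subfield_K emb by (auto simp: F_def embedding_0[OF is_subfield_K] is_subfield_def embedding_def)
    fix y assume y: "y \<in> F"
    show "inverse y \<in> F" if "y \<noteq> 0"
      using y that is_subfield_K embedding_inverse[OF is_subfield_K emb(1)]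
        embedding_inverse[OF is_subfield_K emb(2)] by (auto simp: F_def is_subfield_def)
    fix z assume z: "z \<in> F"
    show "y + z \<in> F" using y z is_subfield_K embedding_add[OF emb(1)] embedding_add[OF emb(2)]
      by (auto simp: F_def is_subfield_def)
    show "y * z \<in> F" using y z is_subfield_K embedding_mult[OF emb(1)] embedding_mult[OF emb(2)]
      by (auto simp: F_def is_subfield_def)
    have mz: "- z \<in> ?K" using z is_subfield_minus[OF is_subfield_K] by (auto simp: F_def)
    have "emb i (y + - z) = emb j (y + - z)"
      using y z embedding_add[OF emb(1) _ mz] embedding_add[OF emb(2) _ mz]
        embedding_minus[OF is_subfield_K emb(1)] embedding_minus[OF is_subfield_K emb(2)]
      by (auto simp: F_def)
    moreover have "y - z \<in> ?K" using y z is_subfield_K by (auto simp: F_def is_subfield_def)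
    ultimately show "y - z \<in> F" by (simp add: F_def)
  qed
  have "ev x \<in> F" using eq ev_in_K by (simp add: F_def emb_ev)
  then have "?K \<subseteq> F" using sub assms unfolding QQ_adj_def by blast
  then have "of_real t \<in> F" unfolding of_real_t_eq_ev using ev_in_K by blast
  then show "i = j" using emb_inj ij by (simp add: F_def)
qed

text \<open>An integer polynomial vanishing at \<open>ev x\<close> vanishes at its four distinct
  conjugates, so the product over the conjugates has least degree.\<close>

lemma mahler_alg_ev:
  assumes int: "alg_int (ev x)" and inj: "inj_on (\<lambda>j. cj j x) {..<4}"
  shows "mahler_alg (ev x) = (\<Prod>j<4. max 1 \<bar>cj j x\<bar>)"
proof -
  obtain p :: "int poly" where p: "lead_coeff p = 1" "degree p = 4"
    "map_poly of_int p = (\<Prod>j<4. [:- complex_of_real (cj j x), 1:])"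
    using char_poly_int[OF int] .
  have injC: "inj_on (\<lambda>j. complex_of_real (cj j x)) {..<4}"
    using inj by (simp add: inj_on_def)
  have "min_int_poly (ev x) = p"
  proof (rule min_int_poly_eqI)
    show "poly (map_poly of_int p) (ev x) = 0"
      unfolding p(3) poly_prod ev_def by (rule prod_zero) auto
    fix g :: "int poly" assume g: "poly (map_poly of_int g) (ev x) = 0" "g \<noteq> 0"
    let ?g = "map_poly of_int g :: complex poly"
    have "poly ?g (of_real (cj j x)) = 0" if "j < 4" for j
      using embedding_poly[OF is_subfield_K embedding_emb[OF that] ev_in_K[of x], of g]
        embedding_0[OF is_subfield_K embedding_emb[OF that]] g(1) by (simp add: emb_ev)
    then have "(\<lambda>j. complex_of_real (cj j x)) ` {..<4} \<subseteq> {z. poly ?g z = 0}" by auto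
    moreover have g0: "?g \<noteq> 0" using g(2) by simp
    ultimately have "card ((\<lambda>j. complex_of_real (cj j x)) ` {..<4}) \<le> card {z. poly ?g z = 0}"
      by (intro card_mono poly_roots_finite)
    also have "\<dots> \<le> degree ?g" using g0 by (rule card_poly_roots_bound)
    finally show "degree p \<le> degree g"
      by (simp add: card_image[OF injC] p(2) degree_map_poly_of_int)
  qed (use p in auto)
  then show ?thesis
    unfolding mahler_alg_def by (simp add: p(3) mahler_prod_linear[OF injC])
qed

lemma abs_disc_le_mahler:
  assumes int: "alg_int (ev x)" and inj: "inj_on (\<lambda>j. cj j x) {..<4}"
  shows "abs_disc (K_field k) \<le> 256 * (\<Prod>j<4. max 1 \<bar>cj j x\<bar>) ^ 6"
proof -
  let ?K = "K_field k"
  \<comment> \<open>\<open>V\<close> is real, as Hadamard's inequality demands; its complex copy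
    \<open>W\<close> gives the trace matrix of the powers of x as
    \<open>transpose_mat W * W\<close>.\<close>
  define V where "V = mat 4 4 (\<lambda>(j, i). cj j x ^ i)"
  define W :: "complex mat" where "W = mat 4 4 (\<lambda>(j, i). of_real (cj j x) ^ i)"
  have W: "W \<in> carrier_mat 4 4" by (simp add: W_def)
  have detW: "det W = of_real (det V)" unfolding V_def W_def det_vandermonde_4 by simp
  have pow: "ev x ^ n \<in> ?K \<and> emb j (ev x ^ n) = of_real (cj j x) ^ n" if "j < 4" for j n
  proof (induction n)
    case 0
    then show ?case using is_subfield_K embedding_emb[OF that] by (simp add: is_subfield_def embedding_def)
  next
    case (Suc n)
    then show ?case
      using is_subfield_K embedding_mult[OF embedding_emb[OF that] ev_in_K[of x], of "ev x ^ n"] ev_in_K[of x]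
      by (simp add: is_subfield_def emb_ev)
  qed
  have tm: "trace_matrix ?K 4 (\<lambda>i. ev x ^ i) = transpose_mat W * W"
  proof (rule eq_matI)
    fix i l assume "i < dim_row (transpose_mat W * W)" "l < dim_col (transpose_mat W * W)"
    then have il: "i < 4" "l < 4" by (auto simp: W_def)
    have "field_trace ?K (ev x ^ i * ev x ^ l) = (\<Sum>j<4. of_real (cj j x) ^ (i + l))"
      unfolding field_trace_eq power_add[symmetric] using pow by simp
    also have "\<dots> = (transpose_mat W * W) $$ (i, l)"
      using il by (simp add: W_def scalar_prod_def lessThan_atLeast0 power_add)
    finally show "trace_matrix ?K 4 (\<lambda>i. ev x ^ i) $$ (i, l) = (transpose_mat W * W) $$ (i, l)"
      using il by (simp add: trace_matrix_def)
  qed (auto simp: trace_matrix_def W_def)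
  have det: "det (trace_matrix ?K 4 (\<lambda>i. ev x ^ i)) = of_real ((det V)\<^sup>2)"
    unfolding tm using det_mult[of "transpose_mat W" 4 W] det_transpose[OF W] W
    by (simp add: detW power2_eq_square)
  have "cj i x \<noteq> cj j x" if "i < 4" "j < 4" "i \<noteq> j" for i j
    using inj that by (auto simp: inj_on_def)
  then have "det V \<noteq> 0" unfolding V_def det_vandermonde_4 by simp
  then have "abs_disc ?K \<le> cmod (of_real ((det V)\<^sup>2))"
    unfolding det[symmetric]
    by (intro abs_disc_le[OF is_subfield_K integral_basis_K])
      (use pow[of 0] int alg_int_power det in \<open>auto simp: ring_of_integers_def\<close>)
  also have "\<dots> = (det V)\<^sup>2" by (simp only: norm_of_real) simp
  also have "\<dots> \<le> 256 * (\<Prod>j<4. max 1 \<bar>cj j x\<bar>) ^ 6"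
    unfolding V_def by (rule det_vandermonde_4_squared_le)
  finally show ?thesis .
qed

end

lemma power_6_powr:
  fixes x :: real
  assumes "x > 0"
  shows "(x ^ 6) powr (1/6) = x"
proof -
  have "x ^ 6 = x powr 6" using powr_realpow[OF assms, of 6] by simp
  then show ?thesis using assms by (simp only: powr_powr) simp
qed

section \<open>A generator of small Mahler measure and the two bounds\<close>

context quartic
begin

text \<open>For large k, s is about k, t about k + 1/2 and u about k - 1/2. With these signs the
  terms of order k cancel in every conjugate but k + s + t + u.\<close>

definition gen :: quad where "gen = (of_nat k, - 1, 1, - 1)"

lemma alg_int_gen: "alg_int (ev gen)"
proof -
  have "ev gen = of_int (int k) - of_real s + of_real t - of_real u"
    by (simp add: gen_def ev_altdef of_rat_minus)
  then show ?thesis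
    by (simp only: alg_int_diff alg_int_add_mult alg_int_of_int alg_int_s alg_int_t alg_int_u)
qed

text \<open>With \<open>\<alpha> = k - s + t - u\<close> and \<open>w = \<alpha> - k\<close> one has \<open>w\<^sup>2 + 2 \<alpha> s = k\<^sup>2 + 1\<close>, which recovers \<open>s\<close>
  from \<open>\<alpha>\<close>; then \<open>\<beta> = w + s = t - u\<close> gives \<open>2 t = (k + 1) \<beta> + s \<beta>\<close>.\<close>

lemma QQ_adj_gen: "QQ_adj (ev gen) = K_field k"
proof
  show "QQ_adj (ev gen) \<subseteq> K_field k"
    unfolding QQ_adj_def using is_subfield_K ev_in_K by blast
  show "K_field k \<subseteq> QQ_adj (ev gen)"
    unfolding QQ_adj_def
  proof (intro subsetI InterI)
    fix x F assume x: "x \<in> K_field k" and "F \<in> {F. is_subfield F \<and> ev gen \<in> F}"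
    then have F: "is_subfield F" and g: "ev gen \<in> F" by auto
    have add: "x + y \<in> F" "x - y \<in> F" "x * y \<in> F" if "x \<in> F" "y \<in> F" for x y
      using F that unfolding is_subfield_def by blast+
    have inv: "inverse x \<in> F" if "x \<in> F" for x
      using F that unfolding is_subfield_def by (cases "x = 0") auto
    have k: "kC \<in> F" and m: "mC \<in> F" and two: "2 \<in> F" and one: "1 \<in> F"
      using is_subfield_of_int[OF F] is_subfield_of_int[OF F, of 2] is_subfield_of_int[OF F, of 1]
      by (simp_all only: kC_def mC_def of_int_1 of_int_numeral)
    define w where "w = ev gen - kC"
    have w: "w = ev (0, - 1, 1, - 1)"
      by (simp add: w_def gen_def ev_altdef kC_def of_rat_minus)
    have wF: "w \<in> F" unfolding w_def by (intro add g k)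
    have nz: "ev gen \<noteq> 0"
    proof
      assume "ev gen = 0"
      then have "gen = (0, 0, 0, 0)" using ev_inj ev_0 by metis
      then show False by (simp add: gen_def)
    qed
    have "w * w + of_rat 2 * (ev gen * ev (0, 1, 0, 0)) =
        ev (qadd (qmult (0, - 1, 1, - 1) (0, - 1, 1, - 1)) (qscale 2 (qmult gen (0, 1, 0, 0))))"
      unfolding w by (simp only: ev_add ev_mult ev_scale)
    also have "\<dots> = ev (of_nat k ^ 2 + 1, 0, 0, 0)"
      by (simp add: gen_def algebra_simps power2_eq_square)
    also have "\<dots> = mC" by (simp add: ev_rat mC_def of_rat_add of_rat_power)
    finally have "w * w + 2 * (ev gen * of_real s) = mC" by (simp add: of_real_s_eq_ev)
    then have "of_real s = (mC - w * w) * inverse (2 * ev gen)"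
      using nz by (simp add: field_simps)
    also have "\<dots> \<in> F" by (intro add inv m wF two g)
    finally have s: "of_real s \<in> F" .
    have "w + of_real s = ev (0, 0, 1, - 1)"
      unfolding w of_real_s_eq_ev ev_add[symmetric] by simp
    moreover have "w + of_real s \<in> F" by (intro add wF s)
    ultimately have b: "ev (0, 0, 1, - 1) \<in> F" by simp
    have "(1 + kC) * ev (0, 0, 1, - 1) + of_real s * ev (0, 0, 1, - 1) =
        ev (qadd (qscale (1 + of_nat k) (0, 0, 1, - 1)) (qmult (0, 1, 0, 0) (0, 0, 1, - 1)))"
      by (simp only: ev_add ev_scale ev_mult of_real_s_eq_ev) (simp add: of_rat_add kC_def)
    also have "\<dots> = ev (qscale 2 (0, 0, 1, 0))" by simp
    also have "\<dots> = 2 * of_real t" by (simp only: ev_scale of_real_t_eq_ev) simp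
    finally have "of_real t = ((1 + kC) * ev (0, 0, 1, - 1) + of_real s * ev (0, 0, 1, - 1)) * inverse 2"
      by simp
    also have "\<dots> \<in> F" by (intro add inv one two k b s)
    finally have "of_real t \<in> F" .
    then show "x \<in> F" using x ev_in_subfield[OF F] unfolding K_field_eq by blast
  qed
qed

text \<open>The four factors are at most 2, 5 s, 2 and 1. Conjugates 0 and 2 are bounded by s - k =
  1 / (s + k) and (t - u)^2 = 2 s (s - k); conjugate 3 is small because its product with the large
  conjugate 1 is -1.\<close>

lemma mahler_alg_gen_le: "mahler_alg (ev gen) \<le> 20 * s"
proof -
  have k1: "real k \<ge> 1" using k_pos by simp
  note s = s_bounds s_square
  have sk: "(s - real k) * (s + real k) = 1" using s_square by (simp add: algebra_simps power2_eq_square)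
  have sk0: "0 < s - real k" using s_bounds by simp
  have "(s - real k) * 2 \<le> (s - real k) * (s + real k)"
    using sk0 k1 s_bounds by (intro mult_left_mono) auto
  then have sk1: "s - real k \<le> 1 / 2" using sk by simp
  have tu2: "(t - u)\<^sup>2 = 2 * s * (s - real k)"
    unfolding power2_diff t_square u_square using t_u s_square
    by (simp add: algebra_simps power2_eq_square)
  have "2 * s * (s - real k) \<le> 2 * ((s + real k) * (s - real k))"
    using sk0 k1 by (simp add: mult_right_mono)
  then have "(t - u)\<^sup>2 \<le> 2" unfolding tu2 using sk by (simp add: mult.commute)
  also have "\<dots> \<le> (3 / 2)\<^sup>2" by (simp add: power2_eq_square)
  finally have tu: "t - u \<le> 3 / 2" by (rule power2_le_imp_le) simp
  have tu0: "0 < t - u" using u_less_t by simp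
  have "t\<^sup>2 \<le> (2 * s)\<^sup>2"
    unfolding t_square s_square[symmetric] using s_bounds(1) mult_right_mono[of 1 s s]
    by (simp add: power2_eq_square)
  then have t2: "t \<le> 2 * s" by (rule power2_le_imp_le) (use s_bounds in simp)
  have "u\<^sup>2 \<le> s\<^sup>2" unfolding u_square s_square[symmetric] using s_bounds(1) by simp
  then have u1: "u \<le> s" by (rule power2_le_imp_le) (use s_bounds in simp)
  have c0: "cj 0 gen = real k - s + t - u" and c1: "cj 1 gen = real k + s + u + t"
    and c2: "cj 2 gen = real k - s - t + u" and c3: "cj 3 gen = real k + s - u - t"
    by (simp_all add: gen_def cs_def ct_def cu_def of_rat_minus)
  have "cj 1 gen * cj 3 gen = (real k + s)\<^sup>2 - (t\<^sup>2 + u\<^sup>2 + 2 * (t * u))"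
    unfolding c1 c3 by (simp add: power2_eq_square algebra_simps)
  also have "\<dots> = - 1"
    unfolding t_square u_square t_u using s_square by (simp add: power2_eq_square algebra_simps)
  finally have prod: "cj 1 gen * cj 3 gen = - 1" .
  have g1: "cj 1 gen \<ge> 1" unfolding c1 using k1 s_bounds t_pos u_pos by simp
  have "1 * \<bar>cj 3 gen\<bar> \<le> \<bar>cj 1 gen\<bar> * \<bar>cj 3 gen\<bar>" using g1 by (intro mult_right_mono) auto
  also have "\<dots> = 1" unfolding abs_mult[symmetric] prod by simp
  finally have b3: "max 1 \<bar>cj 3 gen\<bar> = 1" by simp
  have b0: "max 1 \<bar>cj 0 gen\<bar> \<le> 2" and b2: "max 1 \<bar>cj 2 gen\<bar> \<le> 2"
    unfolding c0 c2 using sk0 sk1 tu tu0 by (auto simp: abs_le_iff)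
  have b1: "max 1 \<bar>cj 1 gen\<bar> \<le> 5 * s"
    using g1 s_bounds t2 u1 unfolding c1 by auto
  have "mahler_alg (ev gen) = (\<Prod>j<4. max 1 \<bar>cj j gen\<bar>)"
    by (rule mahler_alg_ev[OF alg_int_gen conjugates_distinct[OF QQ_adj_gen]])
  also have "\<dots> = max 1 \<bar>cj 0 gen\<bar> * max 1 \<bar>cj 1 gen\<bar> * (max 1 \<bar>cj 2 gen\<bar> * max 1 \<bar>cj 3 gen\<bar>)"
    by (simp add: eval_nat_numeral mult.assoc)
  also have "\<dots> \<le> 2 * (5 * s) * (2 * 1)"
    unfolding b3 using s_bounds by (intro mult_mono b0 b1 b2) auto
  finally show ?thesis by simp
qed

lemma abs_disc_powr_ge: "2 * s \<le> abs_disc (K_field k) powr (1/6)"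
proof -
  \<comment> \<open>64 m^3 is the smaller of the two possible discriminants.\<close>
  have "(2 * s) ^ 6 = 64 * (s\<^sup>2) ^ 3" by (simp add: power_mult_distrib flip: power_mult)
  also have "\<dots> \<le> abs_disc (K_field k)" unfolding abs_disc_K s_square by simp
  finally have "((2 * s) ^ 6) powr (1/6) \<le> abs_disc (K_field k) powr (1/6)"
    using s_bounds by (intro powr_mono2) auto
  moreover have "((2 * s) ^ 6) powr (1/6) = 2 * s"
    using s_bounds by (intro power_6_powr) simp
  ultimately show ?thesis by simp
qed

lemma mahler_alg_ge:
  assumes "\<alpha> \<in> ring_of_integers (K_field k)" "QQ_adj \<alpha> = K_field k"
  shows "4 powr (-2/3) * abs_disc (K_field k) powr (1/6) \<le> mahler_alg \<alpha>"
proof -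
  obtain x where x: "\<alpha> = ev x" using assms(1) unfolding ring_of_integers_def K_field_eq by auto
  have int: "alg_int (ev x)" using assms(1) x unfolding ring_of_integers_def by simp
  have inj: "inj_on (\<lambda>j. cj j x) {..<4}" using assms(2) x by (intro conjugates_distinct) simp
  define M where "M = (\<Prod>j<4. max 1 \<bar>cj j x\<bar>)"
  have M: "M \<ge> 1" unfolding M_def by (rule prod_ge_1) simp
  have "abs_disc (K_field k) \<le> 256 * M ^ 6"
    unfolding M_def by (rule abs_disc_le_mahler[OF int inj])
  then have "abs_disc (K_field k) powr (1/6) \<le> (256 * M ^ 6) powr (1/6)"
    by (intro powr_mono2) (auto simp: abs_disc_K)
  \<comment> \<open>The sixth root of Hadamard's constant 256 = 4^4 is 4^(2/3), the origin of the
    factor in the lower bound.\<close>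
  also have "\<dots> = (4 powr 4) powr (1/6) * (M ^ 6) powr (1/6)"
    using M by (simp add: powr_mult)
  also have "\<dots> = 4 powr (2/3) * M"
    using M power_6_powr[of M] by (simp only: powr_powr) simp
  finally have "4 powr (-2/3) * abs_disc (K_field k) powr (1/6) \<le> 4 powr (-2/3) * (4 powr (2/3) * M)"
    by (intro mult_left_mono) auto
  also have "\<dots> = M" by (simp add: powr_add[symmetric] flip: mult.assoc)
  finally show ?thesis unfolding x mahler_alg_ev[OF int inj] M_def .
qed

lemma mahler_OK_bounds:
  "4 powr (-2/3) * abs_disc (K_field k) powr (1/6) \<le> mahler_OK (K_field k)"
  "mahler_OK (K_field k) \<le> 60 * abs_disc (K_field k) powr (1/6)"
proof -
  define S where "S = {mahler_alg \<alpha> | \<alpha>. \<alpha> \<in> ring_of_integers (K_field k) \<and> QQ_adj \<alpha> = K_field k}"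
  have gen: "mahler_alg (ev gen) \<in> S"
    unfolding S_def ring_of_integers_def using alg_int_gen QQ_adj_gen ev_in_K by blast
  have ge: "4 powr (-2/3) * abs_disc (K_field k) powr (1/6) \<le> y" if "y \<in> S" for y
    using that mahler_alg_ge unfolding S_def by blast
  then show "4 powr (-2/3) * abs_disc (K_field k) powr (1/6) \<le> mahler_OK (K_field k)"
    unfolding mahler_OK_def S_def[symmetric] using gen by (intro cInf_greatest) auto
  \<comment> \<open>The lower bound just shown also supplies the boundedness under which the infimum
    lies below its members.\<close>
  have "bdd_below S" using ge by (rule bdd_belowI)
  then have "mahler_OK (K_field k) \<le> mahler_alg (ev gen)"
    unfolding mahler_OK_def S_def[symmetric] using gen by (intro cInf_lower)
  also have "\<dots> \<le> 20 * s" by (rule mahler_alg_gen_le)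
  also have "\<dots> \<le> 60 * (2 * s)" using s_bounds by simp
  also have "\<dots> \<le> 60 * abs_disc (K_field k) powr (1/6)" using abs_disc_powr_ge by simp
  finally show "mahler_OK (K_field k) \<le> 60 * abs_disc (K_field k) powr (1/6)" .
qed

end

theorem theorem5p2:
  shows "infinite {k :: nat. k > 0 \<and> squarefree (k^2 + 1)} \<and>
    (\<exists>N. \<forall>k :: nat. k \<ge> N \<longrightarrow> k > 0 \<longrightarrow> squarefree (k^2 + 1) \<longrightarrow>
       4 powr (-2/3) * abs_disc (K_field k) powr (1/6) \<le> mahler_OK (K_field k) \<and>
       mahler_OK (K_field k) \<le> 60 * abs_disc (K_field k) powr (1/6))"
\<comment> \<open>The estimates are uniform in k, so 0 serves as the threshold.\<close>
proof (intro conjI exI[of _ 0] allI impI)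
  show "infinite {k :: nat. k > 0 \<and> squarefree (k^2 + 1)}"
    by (rule infinite_squarefree_square_plus_1)
  fix k :: nat assume "k > 0" "squarefree (k^2 + 1)"
  then interpret quartic k by unfold_locales
  show "4 powr (-2/3) * abs_disc (K_field k) powr (1/6) \<le> mahler_OK (K_field k)"
    "mahler_OK (K_field k) \<le> 60 * abs_disc (K_field k) powr (1/6)"
    by (rule mahler_OK_bounds)+
qed

end
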